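(* Let $R$ be a noetherian ring, $0\to\mathcal F\xrightarrow{\chi}\mathcal G$ injective with $\mathcal F,\mathcal G$ free of ranks $m,n$, $r=n-m\ge0$, and suppose $\operatorname{grade}I_\chi=r+1$. Let $\mathcal H$ be free of rank $l\le n$, $\rho=r-l$. Then every $\lambda:\mathcal G\to\mathcal H$ with $\lambda\chi=0$ satisfies $I_\lambda\subset I_\chi$, in particular $\operatorname{grade}I_\lambda\le r+1$. Moreover: (a) if some such $\lambda$ has $\operatorname{grade}I_\lambda>|\rho|+1$, then $l=1$ and $r$ is odd; (b) if in addition $\chi$ is minimal, the following are equivalent: (1) there is such a $\lambda$ with $\operatorname{grade}I_\lambda>|\rho|+1$; (2) $l=1$ and either $r=1$, or $m=1$ and $r\ge3$ is odd; (c) for such a $\lambda$: $\operatorname{grade}I_\lambda>|\rho|+1$ if and only if $I_\lambda=I_\chi$.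
   Context: $I_\chi$, $I_\lambda$ are the ideals generated by the maximal minors of matrices representing $\chi$, $\lambda$. A homomorphism of finite free modules is minimal if the entries of a representing matrix generate a proper ideal of $R$.
   Formalization: The rank l of H is assumed to be at least 1: for l = 0 the empty minor is 1, so I_λ = R, while I_χ is proper because its grade is finite, and the inclusion I_λ ⊂ I_χ fails. *)

theory Defs
  imports "Jordan_Normal_Form.Determinant" "Jordan_Normal_Form.DL_Submatrix"
    "HOL-Library.Extended_Nat"
begin

definition ideal_gen :: "'a::comm_ring_1 set \<Rightarrow> 'a set" where
  "ideal_gen S = {x. \<exists>F c. finite F \<and> F \<subseteq> S \<and> x = (\<Sum>s\<in>F. c s * s)}"

definition is_ideal :: "'a::comm_ring_1 set \<Rightarrow> bool" where
  "is_ideal I \<longleftrightarrow> 0 \<in> I \<and> (\<forall>x\<in>I. \<forall>y\<in>I. x + y \<in> I) \<and> (\<forall>r. \<forall>x\<in>I. r * x \<in> I)"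

definition noetherian_ring :: "'a::comm_ring_1 itself \<Rightarrow> bool" where
  "noetherian_ring _ \<longleftrightarrow>
     (\<forall>I::'a set. is_ideal I \<longrightarrow> (\<exists>F. finite F \<and> F \<subseteq> I \<and> I = ideal_gen F))"

definition regular_seq :: "'a::comm_ring_1 set \<Rightarrow> 'a list \<Rightarrow> bool" where
  "regular_seq I xs \<longleftrightarrow> set xs \<subseteq> I \<and> ideal_gen (set xs) \<noteq> UNIV \<and>
     (\<forall>i<length xs. \<forall>y. xs ! i * y \<in> ideal_gen (set (take i xs)) \<longrightarrow> y \<in> ideal_gen (set (take i xs)))"

definition grade :: "'a::comm_ring_1 set \<Rightarrow> enat" where
  "grade I = (if I = UNIV then \<infinity> else Sup {enat (length xs) | xs. regular_seq I xs})"

definition maxminors_ideal :: "'a::comm_ring_1 mat \<Rightarrow> 'a set" where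
  "maxminors_ideal A = ideal_gen {det (submatrix A I J) | I J.
      I \<subseteq> {..<dim_row A} \<and> J \<subseteq> {..<dim_col A} \<and>
      card I = min (dim_row A) (dim_col A) \<and> card J = min (dim_row A) (dim_col A)}"

definition minimal_mat :: "'a::comm_ring_1 mat \<Rightarrow> bool" where
  "minimal_mat A \<longleftrightarrow> ideal_gen {A $$ (i, j) | i j. i < dim_row A \<and> j < dim_col A} \<noteq> UNIV"

end

theory Submission
  imports Defs "HOL-Library.Function_Algebras" "HOL-Library.Disjoint_Sets"
begin

text \<open>For \<open>l\<close> linear forms \<open>f\<^sub>1, \<dots>, f\<^sub>l\<close> on a free module \<open>G\<close> of rank \<open>n\<close>, consider the complex built
  from divided powers of the free module of rank \<open>l\<close> and exterior powers of \<open>G\<close>, with the contractions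
  by the \<open>f\<^sub>i\<close> as differential, spliced by the composition of all contractions with \<open>\<Lambda>\<^sup>q G\<close>. The ideal
  \<open>I\<close> of \<open>l\<close>-minors annihilates its homology by an explicit homotopy, so the complex is exact in
  the range allowed by the grade of \<open>I\<close>. This is used three times.

  For the columns of \<open>\<chi>\<close> and \<open>q = 1\<close> it says that every row of \<open>\<lambda>\<close> is a combination of Cramer
  relations, hence has entries in \<open>I\<^sub>\<chi>\<close>, so \<open>I\<^sub>\<lambda>\<close> is contained in the \<open>l\<close>-th power of \<open>I\<^sub>\<chi>\<close>. For the
  rows of \<open>\<lambda>\<close> and \<open>q = m\<close> it applies to the wedge product of the columns of \<open>\<chi>\<close>, whose coordinates
  are the maximal minors of \<open>\<chi>\<close>: if \<open>grade I\<^sub>\<lambda> > |\<rho>| + 1\<close>, then \<open>I\<^sub>\<chi> \<subseteq> I\<^sub>\<lambda>\<close>. Thus \<open>I\<^sub>\<lambda> = I\<^sub>\<chi>\<close>, and \<open>l \<ge> 2\<close>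
  would make \<open>I\<^sub>\<chi>\<close> idempotent. Finally, the relations between the maximal minors of \<open>\<chi>\<close> have
  coefficients in the ideal of entries. If \<open>l = 1\<close> and \<open>\<chi>\<close> is minimal, the \<open>n choose m\<close> minors
  generate the same ideal as the \<open>n\<close> entries of \<open>\<lambda>\<close>, so \<open>n choose m \<le> n\<close> and \<open>m = 1\<close> or \<open>r = 1\<close>; for \<open>m = 1\<close>
  the transition matrix is alternating and invertible modulo a proper ideal, so \<open>n\<close> is even. The
  parity of \<open>r\<close> in general follows in the same way after passing to a non-nilpotent minor of maximal
  size modulo \<open>I\<^sub>\<chi>\<close>.\<close>

subsection \<open>Ideals\<close>

lemma is_ideal_zero: "is_ideal I \<Longrightarrow> 0 \<in> I"
  and is_ideal_add: "is_ideal I \<Longrightarrow> x \<in> I \<Longrightarrow> y \<in> I \<Longrightarrow> x + y \<in> I"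
  and is_ideal_mult: "is_ideal I \<Longrightarrow> x \<in> I \<Longrightarrow> r * x \<in> I"
  by (auto simp: is_ideal_def)

lemma is_ideal_uminus: "is_ideal I \<Longrightarrow> x \<in> I \<Longrightarrow> - x \<in> I"
  using is_ideal_mult[of I x "-1"] by simp

lemma is_ideal_diff: "is_ideal I \<Longrightarrow> x \<in> I \<Longrightarrow> y \<in> I \<Longrightarrow> x - y \<in> I"
  using is_ideal_add[of I x "- y"] is_ideal_uminus by auto

lemma is_ideal_mult_right: "is_ideal I \<Longrightarrow> x \<in> I \<Longrightarrow> x * r \<in> I"
  using is_ideal_mult[of I x r] by (simp add: mult.commute)

lemma is_ideal_sum: "is_ideal I \<Longrightarrow> (\<And>i. i \<in> A \<Longrightarrow> f i \<in> I) \<Longrightarrow> (\<Sum>i\<in>A. f i) \<in> I"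
  by (induction A rule: infinite_finite_induct) (auto simp: is_ideal_zero is_ideal_add)

lemma is_ideal_UNIV_iff: "is_ideal I \<Longrightarrow> I = UNIV \<longleftrightarrow> 1 \<in> I"
  using is_ideal_mult[of I 1] by auto

lemma is_ideal_trivial: "is_ideal {0::'a::comm_ring_1}"
  by (simp add: is_ideal_def)

lemma ideal_gen_superset: "S \<subseteq> ideal_gen S"
proof
  fix s assume "s \<in> S"
  then show "s \<in> ideal_gen S"
    unfolding ideal_gen_def by (intro CollectI exI[of _ "{s}"] exI[of _ "\<lambda>_. 1"]) simp
qed

lemma is_ideal_gen: "is_ideal (ideal_gen S)"
  unfolding is_ideal_def
proof (intro conjI ballI allI)
  show "0 \<in> ideal_gen S"
    unfolding ideal_gen_def by (intro CollectI exI[of _ "{}"]) simp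
next
  fix x y assume "x \<in> ideal_gen S" "y \<in> ideal_gen S"
  then obtain F c G d where F: "finite F" "F \<subseteq> S" "x = (\<Sum>s\<in>F. c s * s)"
    and G: "finite G" "G \<subseteq> S" "y = (\<Sum>s\<in>G. d s * s)"
    unfolding ideal_gen_def by blast
  define e where "e s = (if s \<in> F then c s else 0) + (if s \<in> G then d s else 0)" for s
  have "x = (\<Sum>s\<in>F\<union>G. (if s \<in> F then c s else 0) * s)"
    unfolding F(3) using F(1) G(1) by (intro sum.mono_neutral_cong_left) auto
  moreover have "y = (\<Sum>s\<in>F\<union>G. (if s \<in> G then d s else 0) * s)"
    unfolding G(3) using F(1) G(1) by (intro sum.mono_neutral_cong_left) auto
  ultimately have "x + y = (\<Sum>s\<in>F\<union>G. e s * s)"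
    by (simp add: e_def distrib_right sum.distrib)
  with F G show "x + y \<in> ideal_gen S"
    unfolding ideal_gen_def by (intro CollectI exI[of _ "F \<union> G"] exI[of _ e]) auto
next
  fix r x assume "x \<in> ideal_gen S"
  then obtain F c where F: "finite F" "F \<subseteq> S" "x = (\<Sum>s\<in>F. c s * s)"
    unfolding ideal_gen_def by blast
  then have "r * x = (\<Sum>s\<in>F. (r * c s) * s)"
    by (simp add: sum_distrib_left mult.assoc)
  with F show "r * x \<in> ideal_gen S"
    unfolding ideal_gen_def by (intro CollectI exI[of _ F] exI[of _ "\<lambda>s. r * c s"]) auto
qed

lemma ideal_gen_least: "is_ideal I \<Longrightarrow> S \<subseteq> I \<Longrightarrow> ideal_gen S \<subseteq> I"
  unfolding ideal_gen_def by (auto intro!: is_ideal_sum is_ideal_mult)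

lemma ideal_gen_empty: "ideal_gen {} = {0}"
  unfolding ideal_gen_def by auto

text \<open>The elements congruent to a multiple of \<open>a\<close> modulo
  \<open>ideal_gen S\<close> form an ideal that contains \<open>insert a S\<close>. The rule relates
  the ideals of two consecutive initial segments of a regular sequence.\<close>

lemma ideal_gen_insertE:
  assumes "x \<in> ideal_gen (insert a S)"
  obtains y where "x - a * y \<in> ideal_gen S"
proof -
  let ?I = "{x. \<exists>y. x - a * y \<in> ideal_gen S}"
  note I = is_ideal_gen[of S]
  have "is_ideal ?I"
    unfolding is_ideal_def
  proof (intro conjI ballI allI)
    show "0 \<in> ?I" using is_ideal_zero[OF I] by (auto intro: exI[of _ 0])
  next
    fix x y assume "x \<in> ?I" "y \<in> ?I"
    then obtain u v where "x - a * u \<in> ideal_gen S" "y - a * v \<in> ideal_gen S" by auto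
    then have "(x - a * u) + (y - a * v) \<in> ideal_gen S" using is_ideal_add[OF I] by blast
    moreover have "(x - a * u) + (y - a * v) = (x + y) - a * (u + v)" by (simp add: algebra_simps)
    ultimately have "(x + y) - a * (u + v) \<in> ideal_gen S" by simp
    then show "x + y \<in> ?I" by blast
  next
    fix r x assume "x \<in> ?I"
    then obtain u where "x - a * u \<in> ideal_gen S" by auto
    then have "r * (x - a * u) \<in> ideal_gen S" using is_ideal_mult[OF I] by blast
    moreover have "r * (x - a * u) = r * x - a * (r * u)" by (simp add: algebra_simps)
    ultimately have "r * x - a * (r * u) \<in> ideal_gen S" by simp
    then show "r * x \<in> ?I" by blast
  qed
  moreover have "a \<in> ?I"
    using is_ideal_zero[OF I] by (auto intro: exI[of _ 1])
  moreover have "S \<subseteq> ?I"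
    using ideal_gen_superset[of S] by (intro subsetI CollectI exI[of _ 0]) auto
  ultimately have "is_ideal ?I" "insert a S \<subseteq> ?I"
    by auto
  then have "ideal_gen (insert a S) \<subseteq> ?I" by (rule ideal_gen_least)
  with assms that show thesis by blast
qed

subsection \<open>Exterior algebra\<close>

text \<open>An element of the exterior algebra of a free module with basis \<open>e\<^sub>0, \<dots>, e\<^sub>n\<^sub>-\<^sub>1\<close> is
  given by its coordinates, one for every set \<open>S\<close> of indices (the coefficient of the
  wedge product of the \<open>e\<^sub>j\<close>, \<open>j \<in> S\<close>, in increasing order).\<close>

type_synonym 'a ext = "nat set \<Rightarrow> 'a"

definition scl :: "'a::comm_ring_1 \<Rightarrow> 'a ext \<Rightarrow> 'a ext" where
  "scl a u = (\<lambda>S. a * u S)"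

text \<open>The sign of moving e_j past the smaller basis vectors of \<open>S\<close> to its place
  in increasing order.\<close>

definition sg :: "nat \<Rightarrow> nat set \<Rightarrow> 'a::comm_ring_1" where
  "sg j S = (- 1) ^ card {i \<in> S. i < j}"

text \<open>Interior product with the dual basis vector of e_j; \<open>eps\<close> is left exterior
  multiplication by e_j.\<close>

definition iota :: "nat \<Rightarrow> 'a::comm_ring_1 ext \<Rightarrow> 'a ext" where
  "iota j u = (\<lambda>S. if j \<in> S then 0 else sg j S * u (insert j S))"

definition eps :: "nat \<Rightarrow> 'a::comm_ring_1 ext \<Rightarrow> 'a ext" where
  "eps j u = (\<lambda>S. if j \<in> S then sg j S * u (S - {j}) else 0)"

definition ctr :: "nat \<Rightarrow> (nat \<Rightarrow> 'a) \<Rightarrow> 'a::comm_ring_1 ext \<Rightarrow> 'a ext" where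
  "ctr n f u = (\<Sum>j<n. scl (f j) (iota j u))"

definition wdg :: "nat \<Rightarrow> (nat \<Rightarrow> 'a) \<Rightarrow> 'a::comm_ring_1 ext \<Rightarrow> 'a ext" where
  "wdg n g u = (\<Sum>j<n. scl (g j) (eps j u))"

definition bas :: "nat set \<Rightarrow> 'a::comm_ring_1 ext" where
  "bas K = (\<lambda>S. if S = K then 1 else 0)"

text \<open>A lower bound on degrees: the filtration by degree instead of the grading. It suffices
  for inductions that end where the degree exceeds \<open>n\<close>.\<close>

definition low :: "nat \<Rightarrow> nat \<Rightarrow> 'a::comm_ring_1 ext \<Rightarrow> bool" where
  "low n p u \<longleftrightarrow> (\<forall>S. u S \<noteq> 0 \<longrightarrow> S \<subseteq> {..<n} \<and> p \<le> card S)"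

definition vanishes_mod :: "'a::comm_ring_1 set \<Rightarrow> 'a ext \<Rightarrow> bool" where
  "vanishes_mod J u \<longleftrightarrow> (\<forall>S. u S \<in> J)"

definition lin :: "('a::comm_ring_1 ext \<Rightarrow> 'a ext) \<Rightarrow> bool" where
  "lin X \<longleftrightarrow> (\<forall>u v. X (u + v) = X u + X v) \<and> (\<forall>a u. X (scl a u) = scl a (X u))"

text \<open>The method \<open>induction\<close> eta-expands functions in its subgoals; the default rules for pointwise
  application would then take sums of functions apart.\<close>

lemmas pointwise = plus_fun_apply zero_fun_apply uminus_apply minus_apply

declare pointwise [simp del]

lemma sum_fun_apply: "(\<Sum>i\<in>A. f i) x = (\<Sum>i\<in>A. f i x)"
  for f :: "'b \<Rightarrow> 'c \<Rightarrow> 'd::comm_monoid_add"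
  by (induction A rule: infinite_finite_induct) (auto simp: pointwise)

lemma scl_apply: "scl a u S = a * u S"
  by (simp add: scl_def)

lemma scl_simps [simp]:
  "scl 1 u = u" "scl 0 u = 0" "scl a 0 = 0" "scl a (scl b u) = scl (a * b) u"
  "scl a (- u) = - scl a u" "scl (- a) u = - scl a u"
  by (auto simp: scl_def fun_eq_iff pointwise algebra_simps)

lemma scl_add: "scl a (u + v) = scl a u + scl a v"
  and scl_add_left: "scl (a + b) u = scl a u + scl b u"
  and scl_diff: "scl a (u - v) = scl a u - scl a v"
  by (auto simp: scl_def fun_eq_iff pointwise algebra_simps)

lemma scl_sum: "scl a (\<Sum>i\<in>A. f i) = (\<Sum>i\<in>A. scl a (f i))"
  by (rule ext) (simp add: scl_def sum_fun_apply sum_distrib_left)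

lemma scl_sum_left: "scl (\<Sum>i\<in>A. f i) u = (\<Sum>i\<in>A. scl (f i) u)"
  by (rule ext) (simp add: scl_def sum_fun_apply sum_distrib_right)

lemma sg_sq [simp]: "sg j S * sg j S = 1"
  by (simp add: sg_def flip: power_add mult_2)

lemma sg_sq_left [simp]: "sg j S * (sg j S * x) = x"
  by (simp flip: mult.assoc)

lemma sg_empty [simp]: "sg j {} = 1"
  by (simp add: sg_def)

lemma sg_insert_ge: "j \<le> k \<Longrightarrow> sg j (insert k S) = sg j S"
  unfolding sg_def by (rule arg_cong[where f = "\<lambda>A. (-1) ^ card A"]) auto

lemma sg_insert_less:
  assumes "k < j" "k \<notin> S"
  shows "sg j (insert k S) = - sg j S"
proof -
  have "{i \<in> insert k S. i < j} = insert k {i \<in> S. i < j}"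
    using assms by auto
  moreover have "finite {i \<in> S. i < j}"
    by (rule finite_subset[of _ "{..<j}"]) auto
  ultimately show ?thesis
    using assms by (simp add: sg_def)
qed

lemma sg_remove_ge: "j \<le> k \<Longrightarrow> sg j (S - {k}) = sg j S"
  unfolding sg_def by (rule arg_cong[where f = "\<lambda>A. (-1) ^ card A"]) auto

lemma sg_remove_less: "k < j \<Longrightarrow> k \<in> S \<Longrightarrow> (sg j (S - {k}) :: 'a::comm_ring_1) = - sg j S"
  using sg_insert_less[of k j "S - {k}", where 'a = 'a] by (simp add: insert_absorb)

lemma iota_anticomm:
  fixes u :: "'a::comm_ring_1 ext"
  shows "iota j (iota k u) = - iota k (iota j u)"
proof
  fix S
  show "iota j (iota k u) S = (- iota k (iota j u)) S"
  proof (cases "j = k \<or> j \<in> S \<or> k \<in> S")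
    case False
    then have "sg j S * sg k (insert j S) = - (sg k S * sg j (insert k S) :: 'a)"
      by (cases j k rule: linorder_cases) (simp_all add: sg_insert_ge sg_insert_less mult.commute)
    then have "sg j S * (sg k (insert j S) * u (insert k (insert j S)))
        = - (sg k S * (sg j (insert k S) * u (insert k (insert j S))))"
      by (simp flip: mult.assoc)
    with False show ?thesis
      by (simp add: pointwise iota_def insert_commute[of j k])
  qed (auto simp: pointwise iota_def)
qed

lemma iota_iota_same [simp]: "iota j (iota j u) = 0"
  by (auto simp: pointwise iota_def fun_eq_iff)

text \<open>The canonical anticommutation relations. For distinct indices the terms cancel because
  inserting or removing the smaller index flips the sign of the larger one, and not
  conversely.\<close>

lemma iota_eps:
  fixes u :: "'a::comm_ring_1 ext"
  shows "iota j (eps k u) + eps k (iota j u) = (if j = k then u else 0)"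
proof
  fix S
  show "(iota j (eps k u) + eps k (iota j u)) S = (if j = k then u else 0) S"
  proof (cases "j \<notin> S \<and> k \<in> S")
    case True
    then have *: "insert j S - {k} = insert j (S - {k})" "j \<noteq> k"
      by auto
    have "sg j S * sg k (insert j S) = - (sg k S * sg j (S - {k}) :: 'a)"
      using True by (cases j k rule: linorder_cases)
        (simp_all add: sg_insert_ge sg_insert_less sg_remove_ge sg_remove_less mult.commute)
    then have "sg j S * (sg k (insert j S) * u (insert j (S - {k})))
        = - (sg k S * (sg j (S - {k}) * u (insert j (S - {k}))))"
      by (simp flip: mult.assoc)
    with True * show ?thesis
      by (simp add: pointwise iota_def eps_def)
  next
    case False
    then show ?thesis
    proof (cases "j = k")
      case True
      then show ?thesis
        by (cases "j \<in> S") (simp_all add: pointwise iota_def eps_def sg_insert_ge sg_remove_ge insert_absorb)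
    next
      case neq: False
      with False show ?thesis
        by (auto simp: pointwise iota_def eps_def)
    qed
  qed
qed

lemma lin_add: "lin X \<Longrightarrow> X (u + v) = X u + X v"
  and lin_scl: "lin X \<Longrightarrow> X (scl a u) = scl a (X u)"
  by (auto simp: lin_def)

lemma lin_zero: "lin X \<Longrightarrow> X 0 = 0"
  using lin_scl[of X 0 0] by simp

lemma lin_uminus: "lin X \<Longrightarrow> X (- u) = - X u"
  using lin_scl[of X "-1" u] by simp

lemma lin_diff: "lin X \<Longrightarrow> X (u - v) = X u - X v"
  using lin_add[of X u "- v"] by (simp only: lin_uminus add_uminus_conv_diff)

lemma lin_sum: "lin X \<Longrightarrow> X (\<Sum>i\<in>A. f i) = (\<Sum>i\<in>A. X (f i))"
  by (induction A rule: infinite_finite_induct) (auto simp: lin_zero lin_add)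

lemmas lin_simps = lin_add lin_scl lin_zero lin_uminus lin_diff lin_sum

lemma lin_iota: "lin (iota j)"
  unfolding lin_def fun_eq_iff by (simp add: pointwise iota_def scl_def distrib_left mult.left_commute)

lemma lin_eps: "lin (eps j)"
  unfolding lin_def fun_eq_iff by (simp add: pointwise eps_def scl_def distrib_left mult.left_commute)

lemma lin_comp: "lin X \<Longrightarrow> lin Y \<Longrightarrow> lin (\<lambda>u. X (Y u))"
  by (auto simp: lin_def)

lemma lin_sum_scl: "(\<And>i. i \<in> A \<Longrightarrow> lin (X i)) \<Longrightarrow> lin (\<lambda>u. \<Sum>i\<in>A. scl (c i) (X i u))"
  unfolding lin_def fun_eq_iff
  by (simp add: pointwise sum_fun_apply scl_apply distrib_left sum.distrib sum_distrib_left mult.left_commute)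

lemma lin_ctr: "lin (ctr n f)"
  unfolding ctr_def[abs_def] by (intro lin_sum_scl lin_iota)

lemma lin_wdg: "lin (wdg n f)"
  unfolding wdg_def[abs_def] by (intro lin_sum_scl lin_eps)

text \<open>The vanishing diagonal is assumed separately because antisymmetry does not imply it in
  the presence of 2-torsion.\<close>

lemma sum_antisymmetric:
  fixes h :: "nat \<Rightarrow> nat \<Rightarrow> 'b::ab_group_add"
  assumes "\<And>j k. h j k = - h k j" "\<And>j. h j j = 0"
  shows "(\<Sum>j<n. \<Sum>k<n. h j k) = 0"
proof (induction n)
  case (Suc n)
  have "(\<Sum>j<n. h j n) = - (\<Sum>k<n. h n k)"
    unfolding sum_negf[symmetric] by (intro sum.cong refl assms(1))
  with Suc assms(2) show ?case
    by (simp add: sum.distrib)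
qed simp

lemma ctr_ctr: "ctr n f (ctr n g u) = (\<Sum>j<n. \<Sum>k<n. scl (f j * g k) (iota j (iota k u)))"
  unfolding ctr_def by (simp add: lin_simps[OF lin_iota] scl_sum)

lemma ctr_anticomm: "ctr n f (ctr n g u) = - ctr n g (ctr n f u)"
proof -
  have "ctr n f (ctr n g u) = (\<Sum>k<n. \<Sum>j<n. scl (f j * g k) (iota j (iota k u)))"
    unfolding ctr_ctr by (rule sum.swap)
  also have "\<dots> = (\<Sum>k<n. \<Sum>j<n. - scl (g k * f j) (iota k (iota j u)))"
    by (intro sum.cong refl) (subst iota_anticomm, simp add: mult.commute)
  also have "\<dots> = - ctr n g (ctr n f u)"
    unfolding ctr_ctr by (simp add: sum_negf)
  finally show ?thesis .
qed

lemma ctr_ctr_same [simp]: "ctr n f (ctr n f u) = 0"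
  unfolding ctr_ctr
proof (rule sum_antisymmetric)
  show "scl (f j * f k) (iota j (iota k u)) = - scl (f k * f j) (iota k (iota j u))" for j k
    by (subst iota_anticomm) (simp add: mult.commute)
qed simp

lemma ctr_iota: "ctr n f (iota j u) = - iota j (ctr n f u)"
proof -
  have "scl (f k) (iota k (iota j u)) = - scl (f k) (iota j (iota k u))" for k
    by (subst iota_anticomm) simp
  then show ?thesis
    unfolding ctr_def by (simp add: lin_simps[OF lin_iota] sum_negf)
qed

text \<open>Contraction is an antiderivation of the exterior algebra; this sums the relations
  \<open>iota_eps\<close> over all pairs of indices.\<close>

lemma ctr_wdg: "ctr n f (wdg n g u) = scl (\<Sum>j<n. f j * g j) u - wdg n g (ctr n f u)"
proof -
  have "ctr n f (wdg n g u) = (\<Sum>j<n. \<Sum>k<n. scl (f j * g k) (iota j (eps k u)))"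
    unfolding ctr_def wdg_def by (simp add: lin_simps[OF lin_iota] scl_sum)
  moreover have "wdg n g (ctr n f u) = (\<Sum>j<n. \<Sum>k<n. scl (f j * g k) (eps k (iota j u)))"
    unfolding ctr_def wdg_def
    by (subst sum.swap) (simp add: lin_simps[OF lin_eps] scl_sum mult.commute)
  ultimately have "ctr n f (wdg n g u) + wdg n g (ctr n f u)
      = (\<Sum>j<n. \<Sum>k<n. scl (f j * g k) (iota j (eps k u) + eps k (iota j u)))"
    by (simp add: sum.distrib scl_add)
  also have "\<dots> = (\<Sum>j<n. \<Sum>k<n. if j = k then scl (f j * g k) u else 0)"
    by (intro sum.cong refl) (auto simp: iota_eps)
  also have "\<dots> = scl (\<Sum>j<n. f j * g j) u"
    by (simp add: scl_sum_left)
  finally show ?thesis by (simp add: algebra_simps)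
qed

section \<open>Degree bounds and reduction modulo an ideal\<close>

lemma low_mono: "low n p u \<Longrightarrow> q \<le> p \<Longrightarrow> low n q u"
  unfolding low_def by (meson order_trans)

lemma low_zero [simp]: "low n p 0"
  by (simp add: low_def pointwise)

lemma low_add: "low n p u \<Longrightarrow> low n p v \<Longrightarrow> low n p (u + v)"
  unfolding low_def pointwise by (metis add_0)

lemma low_scl: "low n p u \<Longrightarrow> low n p (scl a u)"
  unfolding low_def scl_apply by (metis mult_zero_right)

lemma low_uminus: "low n p u \<Longrightarrow> low n p (- u)"
  unfolding low_def by (auto simp: pointwise)

lemma low_diff: "low n p u \<Longrightarrow> low n p v \<Longrightarrow> low n p (u - v)"
  using low_add[of n p u "- v"] by (simp add: low_uminus)

lemma low_sum: "(\<And>i. i \<in> A \<Longrightarrow> low n p (f i)) \<Longrightarrow> low n p (\<Sum>i\<in>A. f i)"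
  by (induction A rule: infinite_finite_induct) (auto simp: low_add)

lemma low_eq_0:
  assumes "low n p u" "n < p"
  shows "u = 0"
proof
  fix S
  have "card S \<le> n" if "S \<subseteq> {..<n}"
    using card_mono[OF _ that] by simp
  with assms show "u S = 0 S"
    unfolding low_def by (fastforce simp: pointwise)
qed

lemma low_iota:
  assumes "low n p u"
  shows "low n (p - 1) (iota j u)"
  unfolding low_def
proof (intro allI impI)
  fix S assume "iota j u S \<noteq> 0"
  then have "j \<notin> S" "u (insert j S) \<noteq> 0"
    by (auto simp: pointwise iota_def split: if_splits)
  with assms have S: "insert j S \<subseteq> {..<n}" "p \<le> card (insert j S)"
    by (auto simp: low_def)
  then have "finite S"
    by (meson finite_lessThan finite_insert finite_subset)
  with S \<open>j \<notin> S\<close> show "S \<subseteq> {..<n} \<and> p - 1 \<le> card S"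
    by auto
qed

lemma low_eps:
  assumes "low n p u" "j < n"
  shows "low n (Suc p) (eps j u)"
  unfolding low_def
proof (intro allI impI)
  fix S assume "eps j u S \<noteq> 0"
  then have "j \<in> S" "u (S - {j}) \<noteq> 0"
    by (auto simp: eps_def split: if_splits)
  with assms have S: "S - {j} \<subseteq> {..<n}" "p \<le> card (S - {j})"
    by (auto simp: low_def)
  then have "finite (S - {j})"
    by (meson finite_lessThan finite_subset)
  with \<open>j \<in> S\<close> have "card S = Suc (card (S - {j}))"
    by (metis card.remove finite_Diff2 finite.emptyI finite_insert)
  with S assms(2) show "S \<subseteq> {..<n} \<and> Suc p \<le> card S"
    by auto
qed

lemma low_ctr: "low n p u \<Longrightarrow> low n (p - 1) (ctr n f u)"
  unfolding ctr_def by (intro low_sum low_scl low_iota)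

lemma low_wdg: "low n p u \<Longrightarrow> low n (Suc p) (wdg n f u)"
  unfolding wdg_def by (intro low_sum low_scl low_eps) auto

context
  fixes J :: "'a::comm_ring_1 set"
  assumes J: "is_ideal J"
begin

lemma vanishes_mod_zero: "vanishes_mod J 0"
  by (simp add: vanishes_mod_def pointwise is_ideal_zero[OF J])

lemma vanishes_mod_add: "vanishes_mod J u \<Longrightarrow> vanishes_mod J v \<Longrightarrow> vanishes_mod J (u + v)"
  by (simp add: vanishes_mod_def pointwise is_ideal_add[OF J])

lemma vanishes_mod_diff: "vanishes_mod J u \<Longrightarrow> vanishes_mod J v \<Longrightarrow> vanishes_mod J (u - v)"
  by (simp add: vanishes_mod_def pointwise is_ideal_diff[OF J])

lemma vanishes_mod_scl: "vanishes_mod J u \<Longrightarrow> vanishes_mod J (scl a u)"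
  by (simp add: vanishes_mod_def scl_def is_ideal_mult[OF J])

lemma vanishes_mod_uminus: "vanishes_mod J u \<Longrightarrow> vanishes_mod J (- u)"
  using vanishes_mod_scl[of u "-1"] by simp

lemma vanishes_mod_sum: "(\<And>i. i \<in> A \<Longrightarrow> vanishes_mod J (f i)) \<Longrightarrow> vanishes_mod J (\<Sum>i\<in>A. f i)"
  by (induction A rule: infinite_finite_induct) (auto simp: vanishes_mod_zero vanishes_mod_add)

lemma vanishes_mod_iota: "vanishes_mod J u \<Longrightarrow> vanishes_mod J (iota j u)"
  by (simp add: vanishes_mod_def iota_def is_ideal_mult[OF J] is_ideal_zero[OF J])

lemma vanishes_mod_eps: "vanishes_mod J u \<Longrightarrow> vanishes_mod J (eps j u)"
  by (simp add: vanishes_mod_def eps_def is_ideal_mult[OF J] is_ideal_zero[OF J])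

lemma vanishes_mod_ctr: "vanishes_mod J u \<Longrightarrow> vanishes_mod J (ctr n f u)"
  unfolding ctr_def by (intro vanishes_mod_sum vanishes_mod_scl vanishes_mod_iota)

lemma vanishes_mod_wdg: "vanishes_mod J u \<Longrightarrow> vanishes_mod J (wdg n f u)"
  unfolding wdg_def by (intro vanishes_mod_sum vanishes_mod_scl vanishes_mod_eps)

end

section \<open>Iterated contractions, exterior products and graded commutators\<close>

primrec Fs :: "nat \<Rightarrow> (nat \<Rightarrow> nat \<Rightarrow> 'a) \<Rightarrow> nat \<Rightarrow> 'a::comm_ring_1 ext \<Rightarrow> 'a ext" where
  "Fs n f 0 u = u"
| "Fs n f (Suc l) u = Fs n f l (ctr n (f l) u)"

text \<open>The contractions of \<open>Fs\<close> in the opposite order: here \<open>f 0\<close>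
  acts first, which suits telescoping over initial segments of the forms. The two differ by the sign
  \<open>tri l\<close>.\<close>

primrec As :: "nat \<Rightarrow> (nat \<Rightarrow> nat \<Rightarrow> 'a) \<Rightarrow> nat \<Rightarrow> 'a::comm_ring_1 ext \<Rightarrow> 'a ext" where
  "As n f 0 u = u"
| "As n f (Suc l) u = ctr n (f l) (As n f l u)"

primrec Es :: "nat \<Rightarrow> (nat \<Rightarrow> nat \<Rightarrow> 'a) \<Rightarrow> nat \<Rightarrow> 'a::comm_ring_1 ext \<Rightarrow> 'a ext" where
  "Es n g 0 u = u"
| "Es n g (Suc d) u = wdg n (g 0) (Es n (\<lambda>i. g (Suc i)) d u)"

text \<open>The sign (-1)^(i(i-1)/2) of reversing \<open>i\<close> anticommuting factors.\<close>

primrec tri :: "nat \<Rightarrow> 'a::comm_ring_1" where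
  "tri 0 = 1"
| "tri (Suc i) = (- 1) ^ i * tri i"

text \<open>Graded commutator of the contraction by \<open>f\<close> with an operator
  \<open>X\<close> of degree \<open>d\<close>. The iteration \<open>gcomms\<close> lowers the degree
  from \<open>l\<close> to 0.\<close>

definition gcomm :: "nat \<Rightarrow> (nat \<Rightarrow> 'a) \<Rightarrow> nat \<Rightarrow> ('a::comm_ring_1 ext \<Rightarrow> 'a ext) \<Rightarrow> 'a ext \<Rightarrow> 'a ext" where
  "gcomm n f d X u = ctr n f (X u) - scl ((- 1) ^ d) (X (ctr n f u))"

primrec gcomms :: "nat \<Rightarrow> (nat \<Rightarrow> nat \<Rightarrow> 'a) \<Rightarrow> nat \<Rightarrow> ('a::comm_ring_1 ext \<Rightarrow> 'a ext) \<Rightarrow> 'a ext \<Rightarrow> 'a ext" where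
  "gcomms n f 0 X = X"
| "gcomms n f (Suc l) X = gcomms n f l (gcomm n (f l) (Suc l) X)"

definition pairing :: "nat \<Rightarrow> (nat \<Rightarrow> 'a) \<Rightarrow> (nat \<Rightarrow> 'a) \<Rightarrow> 'a::comm_ring_1" where
  "pairing n f g = (\<Sum>j<n. f j * g j)"

definition skip :: "nat \<Rightarrow> nat \<Rightarrow> nat" where
  "skip i c = (if c < i then c else Suc c)"

lemma neg_one_power_sq: "(- 1) ^ i * (- 1) ^ i = (1::'a::comm_ring_1)"
  by (simp flip: power_add mult_2)

lemma tri_sq: "tri i * tri i = (1::'a::comm_ring_1)"
proof (induction i)
  case (Suc i)
  have "tri (Suc i) * tri (Suc i) = ((-1) ^ i * (-1) ^ i) * (tri i * tri i :: 'a)"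
    by (simp add: algebra_simps)
  with Suc show ?case by (simp add: neg_one_power_sq)
qed simp

lemma tri_sq_left: "tri i * (tri i * x) = (x::'a::comm_ring_1)"
  by (simp add: tri_sq flip: mult.assoc)

lemma lin_Fs: "lin (Fs n f l)"
proof (induction l)
  case (Suc l)
  with lin_comp[OF Suc lin_ctr] show ?case by (simp add: lin_def)
qed (simp add: lin_def)

lemma lin_As: "lin (As n f l)"
proof (induction l)
  case (Suc l)
  with lin_comp[OF lin_ctr Suc] show ?case by (simp add: lin_def)
qed (simp add: lin_def)

lemma ctr_As: "ctr n h (As n f l u) = scl ((- 1) ^ l) (As n f l (ctr n h u))"
proof (induction l)
  case (Suc l)
  have "ctr n h (As n f (Suc l) u) = - ctr n (f l) (ctr n h (As n f l u))"
    by (simp add: ctr_anticomm[of n h])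
  with Suc show ?case
    by (simp add: lin_scl[OF lin_ctr])
qed simp

lemma ctr_Fs: "ctr n h (Fs n f l u) = scl ((- 1) ^ l) (Fs n f l (ctr n h u))"
proof (induction l arbitrary: u)
  case (Suc l)
  have "ctr n h (Fs n f (Suc l) u) = scl ((- 1) ^ l) (Fs n f l (ctr n h (ctr n (f l) u)))"
    by (simp add: Suc)
  then show ?case
    by (simp add: ctr_anticomm[of n h] lin_uminus[OF lin_Fs])
qed simp

lemma iota_Fs: "iota j (Fs n f l u) = scl ((- 1) ^ l) (Fs n f l (iota j u))"
proof (induction l arbitrary: u)
  case (Suc l)
  have "iota j (Fs n f (Suc l) u) = scl ((- 1) ^ l) (Fs n f l (iota j (ctr n (f l) u)))"
    by (simp add: Suc)
  moreover have "iota j (ctr n (f l) u) = - ctr n (f l) (iota j u)"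
    by (simp add: ctr_iota)
  ultimately show ?case
    by (simp add: lin_uminus[OF lin_Fs])
qed simp

lemma As_eq_Fs: "As n f l u = scl (tri l) (Fs n f l u)"
proof (induction l arbitrary: u)
  case (Suc l)
  have "As n f (Suc l) u = scl ((- 1) ^ l) (As n f l (ctr n (f l) u))"
    by (simp add: ctr_As)
  with Suc show ?case by simp
qed simp

text \<open>Contractions anticommute and square to zero, so a repeated form gives zero.\<close>

lemma As_ctr_eq_0: "k < l \<Longrightarrow> As n f l (ctr n (f k) u) = 0"
proof (induction l)
  case (Suc l)
  show ?case
  proof (cases "k = l")
    case True
    then show ?thesis
      by (simp add: ctr_As lin_zero[OF lin_As])
  next
    case False
    with Suc show ?thesis
      by (simp add: lin_zero[OF lin_ctr])
  qed
qed simp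

lemma ctr_Fs_eq_0: "k < l \<Longrightarrow> ctr n (f k) (Fs n f l u) = 0"
  using As_ctr_eq_0[of k l n f u]
  by (simp add: As_eq_Fs ctr_Fs) (metis scl_simps(1,3,4) tri_sq)

lemma vanishes_mod_As: "is_ideal J \<Longrightarrow> vanishes_mod J u \<Longrightarrow> vanishes_mod J (As n f l u)"
  by (induction l) (auto intro: vanishes_mod_ctr)

lemma low_As: "low n p u \<Longrightarrow> low n (p - l) (As n f l u)"
proof (induction l)
  case (Suc l)
  then show ?case using low_ctr[of n "p - l"] by simp
qed simp

text \<open>What the homotopy needs of an operator: linearity, compatibility with reduction modulo
  every ideal, and a rise of the degree by \<open>d\<close>. A graded commutator inherits this with
  \<open>d\<close> lowered by one.\<close>

definition gop :: "nat \<Rightarrow> nat \<Rightarrow> ('a::comm_ring_1 ext \<Rightarrow> 'a ext) \<Rightarrow> bool" where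
  "gop n d X \<longleftrightarrow> lin X \<and> (\<forall>J u. is_ideal J \<longrightarrow> vanishes_mod J u \<longrightarrow> vanishes_mod J (X u))
     \<and> (\<forall>p u. low n p u \<longrightarrow> low n (p + d) (X u))"

lemma gop_lin: "gop n d X \<Longrightarrow> lin X"
  and gop_vanishes_mod: "gop n d X \<Longrightarrow> is_ideal J \<Longrightarrow> vanishes_mod J u \<Longrightarrow> vanishes_mod J (X u)"
  and gop_low: "gop n d X \<Longrightarrow> low n p u \<Longrightarrow> low n (p + d) (X u)"
  by (auto simp: gop_def)

lemma gop_Es: "gop n d (Es n g d)"
proof (induction d arbitrary: g)
  case (Suc d)
  have "lin (Es n g (Suc d))"
    using lin_comp[OF lin_wdg gop_lin[OF Suc]] unfolding lin_def by simp
  moreover have "vanishes_mod J (Es n g (Suc d) u)" if "is_ideal J" "vanishes_mod J u" for J u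
    using gop_vanishes_mod[OF Suc that] that by (simp add: vanishes_mod_wdg)
  moreover have "low n (p + Suc d) (Es n g (Suc d) u)" if "low n p u" for p u
    using low_wdg[OF gop_low[OF Suc that]] by simp
  ultimately show ?case by (simp only: gop_def simp_thms) blast
qed (simp add: gop_def lin_def)

lemma gop_gcomm:
  assumes "gop n (Suc d) X"
  shows "gop n d (gcomm n f (Suc d) X)"
proof -
  have "lin (gcomm n f (Suc d) X)"
    unfolding lin_def gcomm_def
    by (simp add: lin_simps[OF lin_ctr] lin_simps[OF gop_lin[OF assms]])
      (simp add: scl_def fun_eq_iff pointwise algebra_simps)
  moreover have "vanishes_mod J (gcomm n f (Suc d) X u)" if "is_ideal J" "vanishes_mod J u" for J u
    unfolding gcomm_def
    by (intro vanishes_mod_diff vanishes_mod_scl vanishes_mod_ctr that gop_vanishes_mod[OF assms])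
  moreover have "low n (p + d) (gcomm n f (Suc d) X u)" if "low n p u" for p u
    unfolding gcomm_def
  proof (intro low_diff low_scl)
    show "low n (p + d) (ctr n f (X u))"
      using low_ctr[OF gop_low[OF assms that]] by simp
    show "low n (p + d) (X (ctr n f u))"
      using gop_low[OF assms low_ctr[OF that]] by (rule low_mono) simp
  qed
  ultimately show ?thesis by (simp add: gop_def)
qed

text \<open>The graded commutator is a derivation, and on multiplication by a vector it is a scalar
  by \<open>ctr_wdg\<close>. Hence the \<open>i\<close>-th summand loses the \<open>i\<close>-th
  factor, and \<open>skip i\<close> renumbers the others.\<close>

lemma gcomm_Es:
  "gcomm n f (Suc d) (Es n g (Suc d)) u
    = (\<Sum>i<Suc d. scl ((- 1) ^ i * pairing n f (g i)) (Es n (\<lambda>c. g (skip i c)) d u))"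
proof (induction d arbitrary: g)
  case 0
  show ?case
    by (simp add: gcomm_def ctr_wdg pairing_def)
next
  case (Suc d)
  let ?g = "\<lambda>i. g (Suc i)"
  let ?Y = "Es n ?g (Suc d)"
  have "gcomm n f (Suc (Suc d)) (Es n g (Suc (Suc d))) u
      = scl (pairing n f (g 0)) (?Y u) - wdg n (g 0) (gcomm n f (Suc d) ?Y u)"
    unfolding gcomm_def Es.simps(2)[of n g "Suc d"] ctr_wdg pairing_def
    by (simp only: lin_diff[OF lin_wdg] lin_scl[OF lin_wdg]) simp
  also have "?Y u = Es n (\<lambda>c. g (skip 0 c)) (Suc d) u"
    by (simp add: skip_def)
  also have "wdg n (g 0) (gcomm n f (Suc d) ?Y u)
      = (\<Sum>i<Suc d. scl ((- 1) ^ i * pairing n f (?g i)) (Es n (\<lambda>c. g (skip (Suc i) c)) (Suc d) u))"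
    unfolding Suc lin_sum[OF lin_wdg] lin_scl[OF lin_wdg]
  proof (intro sum.cong refl arg_cong2[where f = scl])
    fix i
    have "(\<lambda>c. g (skip (Suc i) (Suc c))) = (\<lambda>c. ?g (skip i c))"
      by (auto simp: skip_def)
    then show "wdg n (g 0) (Es n (\<lambda>c. ?g (skip i c)) d u)
        = Es n (\<lambda>c. g (skip (Suc i) c)) (Suc d) u"
      by (simp add: skip_def)
  qed
  finally show ?case
    unfolding sum.lessThan_Suc_shift[of _ "Suc d"] by (simp add: sum_negf)
qed

lemma gcomms_sum:
  "gcomms n f l (\<lambda>u. \<Sum>i\<in>A. scl (c i) (X i u)) = (\<lambda>u. \<Sum>i\<in>A. scl (c i) (gcomms n f l (X i) u))"
proof (induction l arbitrary: X)
  case (Suc l)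
  have "gcomm n (f l) (Suc l) (\<lambda>u. \<Sum>i\<in>A. scl (c i) (X i u))
      = (\<lambda>u. \<Sum>i\<in>A. scl (c i) (gcomm n (f l) (Suc l) (X i) u))"
    unfolding gcomm_def lin_sum[OF lin_ctr] lin_scl[OF lin_ctr] scl_sum scl_diff sum_subtractf
    by (simp add: mult.commute sum_negf)
  with Suc show ?case by simp
qed simp

text \<open>Each commutator expands a determinant along its last row; the signs left over accumulate
  to \<open>tri l\<close>.\<close>

lemma gcomms_Es:
  "gcomms n f l (Es n g l) u = scl (tri l * det (mat l l (\<lambda>(i, j). pairing n (f i) (g j)))) u"
proof (induction l arbitrary: g u)
  case (Suc l)
  let ?A = "\<lambda>l g. mat l l (\<lambda>(i, j). pairing n (f i) (g j))"
  let ?g = "\<lambda>i c. g (skip i c)"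
  have "gcomms n f (Suc l) (Es n g (Suc l)) u
     = (\<Sum>i<Suc l. scl ((- 1) ^ i * pairing n (f l) (g i)) (gcomms n f l (Es n (?g i) l) u))"
    unfolding gcomms.simps gcomm_Es gcomms_sum ..
  also have "\<dots> = (\<Sum>i<Suc l. scl ((- 1) ^ i * pairing n (f l) (g i) * (tri l * det (?A l (?g i)))) u)"
    unfolding Suc by simp
  also have "\<dots> = scl (tri (Suc l) * det (?A (Suc l) g)) u"
    unfolding scl_sum_left[symmetric]
  proof (rule arg_cong[where f = "\<lambda>x. scl x u"])
    have *: "mat_delete (?A (Suc l) g) l i = ?A l (?g i)" for i
      by (rule eq_matI) (auto simp: mat_delete_def skip_def)
    have "det (?A (Suc l) g) = (\<Sum>i<Suc l. ?A (Suc l) g $$ (l, i) * cofactor (?A (Suc l) g) l i)"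
      by (rule laplace_expansion_row) auto
    also have "\<dots> = (\<Sum>i<Suc l. pairing n (f l) (g i) * ((-1) ^ (l + i) * det (?A l (?g i))))"
      unfolding cofactor_def * by (intro sum.cong) auto
    finally have "tri (Suc l) * det (?A (Suc l) g)
        = (\<Sum>i<Suc l. (-1) ^ l * tri l * (pairing n (f l) (g i) * ((-1) ^ (l + i) * det (?A l (?g i)))))"
      by (simp only: sum_distrib_left tri.simps)
    also have "\<dots> = (\<Sum>i<Suc l. (- 1) ^ i * pairing n (f l) (g i) * (tri l * det (?A l (?g i))))"
    proof (intro sum.cong refl)
      fix i
      have "(-1) ^ l * tri l * (pairing n (f l) (g i) * ((-1) ^ (l + i) * det (?A l (?g i))))
          = ((-1) ^ l * (-1) ^ l) * ((- 1) ^ i * pairing n (f l) (g i) * (tri l * det (?A l (?g i))))"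
        by (simp add: power_add algebra_simps)
      then show "(-1) ^ l * tri l * (pairing n (f l) (g i) * ((-1) ^ (l + i) * det (?A l (?g i))))
          = (- 1) ^ i * pairing n (f l) (g i) * (tri l * det (?A l (?g i)))"
        by (simp only: neg_one_power_sq mult_1)
    qed
    finally show "(\<Sum>i<Suc l. (- 1) ^ i * pairing n (f l) (g i) * (tri l * det (?A l (?g i))))
        = tri (Suc l) * det (?A (Suc l) g)" by simp
  qed
  finally show ?case .
qed simp

text \<open>Keeps all stages of the iterated commutator: \<open>C i\<close> has been commuted with
  \<open>f (l - 1)\<close> down to \<open>f i\<close>.\<close>

lemma gcomm_chain:
  "\<exists>C. C l = X \<and> C 0 = gcomms n f l X \<and> (\<forall>i<l. C i = gcomm n (f i) (Suc i) (C (Suc i)))"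
proof (induction l arbitrary: X)
  case (Suc l)
  from Suc[of "gcomm n (f l) (Suc l) X"] obtain C
    where C: "C l = gcomm n (f l) (Suc l) X" "C 0 = gcomms n f (Suc l) X"
      "\<forall>i<l. C i = gcomm n (f i) (Suc i) (C (Suc i))"
    by auto
  then show ?case
    by (intro exI[of _ "C(Suc l := X)"]) (auto simp: less_Suc_eq)
qed auto

lemma gcomm_chain_gop:
  assumes "\<forall>i<l. C i = gcomm n (f i) (Suc i) (C (Suc i))" "gop n l (C l)" "i \<le> l"
  shows "gop n i (C i)"
  using assms(3)
proof (induction rule: inc_induct)
  case base
  show ?case by (fact assms(2))
next
  case (step i)
  then show ?case
    using assms(1) gop_gcomm[of n i "C (Suc i)" "f i"] by simp
qed

text \<open>The commutator with a contraction, taken twice, vanishes because the contraction squares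
  to zero; later commutators preserve this because contractions anticommute. So \<open>C i\<close>
  commutes up to sign with every form that it was already commuted with.\<close>

lemma gcomm_chain_commute:
  assumes chain: "\<forall>i<l. C i = gcomm n (f i) (Suc i) (C (Suc i))" and gop: "gop n l (C l)"
    and "i \<le> l" "i \<le> k" "k < l"
  shows "ctr n (f k) (C i u) = scl ((- 1) ^ i) (C i (ctr n (f k) u))"
  using assms(3,4)
proof (induction arbitrary: u rule: inc_induct)
  case base
  with \<open>k < l\<close> show ?case by simp
next
  case (step i)
  define D where "D = C (Suc i)"
  have Ci: "C i u = ctr n (f i) (D u) - scl ((- 1) ^ Suc i) (D (ctr n (f i) u))" for u
    using chain step(2) by (simp add: gcomm_def D_def)
  have D: "lin D"
    unfolding D_def using step gcomm_chain_gop[OF chain gop] gop_lin by (metis Suc_leI)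
  show ?case
  proof (cases "k = i")
    case True
    then show ?thesis
      unfolding Ci lin_diff[OF lin_ctr] lin_scl[OF lin_ctr] by (simp add: lin_zero[OF D])
  next
    case False
    with step have IH: "ctr n (f k) (D v) = scl ((- 1) ^ Suc i) (D (ctr n (f k) v))" for v
      unfolding D_def by simp
    have "ctr n (f k) (C i u)
        = - ctr n (f i) (ctr n (f k) (D u)) - scl ((- 1) ^ Suc i) (ctr n (f k) (D (ctr n (f i) u)))"
      unfolding Ci lin_diff[OF lin_ctr] lin_scl[OF lin_ctr] by (simp add: ctr_anticomm[of n "f k"])
    also have "\<dots> = scl ((- 1) ^ i) (C i (ctr n (f k) u))"
      unfolding Ci IH by (simp add: lin_simps[OF lin_ctr] ctr_anticomm[of n "f k" "f i"]
        lin_uminus[OF D] scl_diff neg_one_power_sq scl_add)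
    finally show ?thesis .
  qed
qed

text \<open>Unfolding \<open>C i\<close> as a commutator gives a contraction by \<open>f i\<close>
  and a term in which \<open>f i\<close> acts before \<open>C (Suc i)\<close>. The latter is passed
  on to the next stage.\<close>

lemma gcomm_chain_telescope:
  assumes chain: "\<forall>i<l. C i = gcomm n (f i) (Suc i) (C (Suc i))" and "i \<le> l"
  shows "C 0 v = (\<Sum>k<i. ctr n (f k) (scl (tri k) (C (Suc k) (As n f k v))))
    + scl (tri i) (C i (As n f i v))"
  using \<open>i \<le> l\<close>
proof (induction i)
  case (Suc i)
  have "C i (As n f i v)
      = ctr n (f i) (C (Suc i) (As n f i v)) + scl ((- 1) ^ i) (C (Suc i) (As n f (Suc i) v))"
    using chain Suc(2) by (simp add: gcomm_def)
  then have "scl (tri i) (C i (As n f i v))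
      = ctr n (f i) (scl (tri i) (C (Suc i) (As n f i v)))
        + scl (tri (Suc i)) (C (Suc i) (As n f (Suc i) v))"
    by (simp add: scl_add lin_scl[OF lin_ctr] mult.commute)
  with Suc show ?case
    by (simp add: add.assoc)
qed simp

section \<open>The divided power complex and its homotopy\<close>

text \<open>Families \<open>w\<^sub>\<gamma>\<close> of elements of the exterior algebra, indexed by multi-indices of weight \<open>j\<close>,
  represent the tensor product of the exterior algebra with the \<open>j\<close>-th divided power of a free
  module of rank \<open>l\<close>.\<close>

definition weight :: "nat \<Rightarrow> (nat \<Rightarrow> nat) \<Rightarrow> nat" where
  "weight l \<gamma> = (\<Sum>i<l. \<gamma> i)"

text \<open>The \<open>k\<close>-th variable lowers the \<open>k\<close>-th exponent of a divided
  power monomial with coefficient 1. So the component at \<alpha> receives those whose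
  \<open>k\<close>-th exponent is one larger, without integer factors.\<close>

definition bd :: "nat \<Rightarrow> (nat \<Rightarrow> nat \<Rightarrow> 'a) \<Rightarrow> nat \<Rightarrow> ((nat \<Rightarrow> nat) \<Rightarrow> 'a::comm_ring_1 ext)
    \<Rightarrow> (nat \<Rightarrow> nat) \<Rightarrow> 'a ext" where
  "bd n f l w \<alpha> = (\<Sum>k<l. ctr n (f k) (w (\<alpha>(k := Suc (\<alpha> k)))))"

text \<open>In weight 0 the outgoing map is the splice \<open>As\<close>, in positive weight it is
  \<open>bd\<close>; both are taken modulo \<open>J\<close>.\<close>

definition cycle :: "nat \<Rightarrow> (nat \<Rightarrow> nat \<Rightarrow> 'a) \<Rightarrow> nat \<Rightarrow> 'a set \<Rightarrow> nat
    \<Rightarrow> ((nat \<Rightarrow> nat) \<Rightarrow> 'a::comm_ring_1 ext) \<Rightarrow> bool" where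
  "cycle n f l J j v \<longleftrightarrow>
     (\<forall>\<alpha>. weight l \<alpha> = 0 \<longrightarrow> j = 0 \<longrightarrow> vanishes_mod J (As n f l (v \<alpha>))) \<and>
     (\<forall>\<beta>. Suc (weight l \<beta>) = j \<longrightarrow> vanishes_mod J (bd n f l v \<beta>))"

lemma weight_upd:
  assumes "k < l"
  shows "weight l (\<alpha>(k := x)) + \<alpha> k = weight l \<alpha> + x"
proof -
  have "sum g {..<l} = g k + sum g ({..<l} - {k})" for g :: "nat \<Rightarrow> nat"
    using assms by (intro sum.remove) auto
  from this[of \<alpha>] this[of "\<alpha>(k := x)"]
  have "sum \<alpha> {..<l} = \<alpha> k + sum \<alpha> ({..<l} - {k})"
    "sum (\<alpha>(k := x)) {..<l} = x + sum (\<alpha>(k := x)) ({..<l} - {k})" by auto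
  moreover have "sum (\<alpha>(k := x)) ({..<l} - {k}) = sum \<alpha> ({..<l} - {k})"
    by (intro sum.cong) auto
  ultimately show ?thesis by (simp add: weight_def)
qed

lemma weight_Suc_upd: "k < l \<Longrightarrow> weight l (\<alpha>(k := Suc (\<alpha> k))) = Suc (weight l \<alpha>)"
  using weight_upd[of k l \<alpha> "Suc (\<alpha> k)"] by simp

lemma weight_dec_upd: "k < l \<Longrightarrow> 0 < \<alpha> k \<Longrightarrow> Suc (weight l (\<alpha>(k := \<alpha> k - 1))) = weight l \<alpha>"
  using weight_upd[of k l \<alpha> "\<alpha> k - 1"] by simp

lemma low_bd:
  assumes "\<And>\<gamma>. weight l \<gamma> = Suc (weight l \<alpha>) \<Longrightarrow> low n (Suc p) (w \<gamma>)"
  shows "low n p (bd n f l w \<alpha>)"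
  unfolding bd_def
proof (rule low_sum)
  fix k assume "k \<in> {..<l}"
  then have "low n (Suc p) (w (\<alpha>(k := Suc (\<alpha> k))))"
    by (intro assms weight_Suc_upd) auto
  from low_ctr[OF this, of "f k"] show "low n p (ctr n (f k) (w (\<alpha>(k := Suc (\<alpha> k)))))"
    by simp
qed

text \<open>A multi-index with first nonzero exponent \<open>i\<close> is assigned stage
  \<open>C (Suc i)\<close>, applied to the partial contraction by the forms before \<open>i\<close>
  of the component with that exponent lowered. On cycles the boundary of this family is
  \<open>C 0\<close>.\<close>

lemma cycle_homotopy:
  fixes f :: "nat \<Rightarrow> nat \<Rightarrow> 'a::comm_ring_1"
  assumes J: "is_ideal J"
    and chain: "\<forall>i<l. C i = gcomm n (f i) (Suc i) (C (Suc i))" and gop: "gop n l (C l)"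
    and v: "\<And>\<alpha>. weight l \<alpha> = j \<Longrightarrow> low n p (v \<alpha>)" and cyc: "cycle n f l J j v"
  shows "\<exists>w. (\<forall>\<gamma>. weight l \<gamma> = Suc j \<longrightarrow> low n (Suc p) (w \<gamma>)) \<and>
    (\<forall>\<alpha>. weight l \<alpha> = j \<longrightarrow> vanishes_mod J (bd n f l w \<alpha> - C 0 (v \<alpha>)))"
proof -
  define fst_ix where "fst_ix \<gamma> = (LEAST i. i < l \<and> 0 < \<gamma> i)" for \<gamma> :: "nat \<Rightarrow> nat"
  \<comment> \<open>The default 0 is taken only in weight 0, so never in weight
    \<open>Suc j\<close>.\<close>
  define w where "w \<gamma> = (if \<exists>i<l. 0 < \<gamma> i then let i = fst_ix \<gamma> in
    scl (tri i) (C (Suc i) (As n f i (v (\<gamma>(i := \<gamma> i - 1))))) else 0)" for \<gamma>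
  have fst_ix: "fst_ix \<gamma> < l" "0 < \<gamma> (fst_ix \<gamma>)" "\<And>k. k < fst_ix \<gamma> \<Longrightarrow> \<gamma> k = 0"
    if "\<exists>i<l. 0 < \<gamma> i" for \<gamma>
  proof -
    show *: "fst_ix \<gamma> < l" "0 < \<gamma> (fst_ix \<gamma>)"
      unfolding fst_ix_def using LeastI_ex[OF that] by auto
    fix k assume "k < fst_ix \<gamma>"
    then have "\<not> (k < l \<and> 0 < \<gamma> k)"
      unfolding fst_ix_def by (rule not_less_Least)
    with * \<open>k < fst_ix \<gamma>\<close> show "\<gamma> k = 0" by auto
  qed
  have fst_ixI: "fst_ix \<gamma> = i" if "i < l" "0 < \<gamma> i" "\<And>k. k < i \<Longrightarrow> \<gamma> k = 0" for \<gamma> i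
    unfolding fst_ix_def
  proof (rule Least_equality)
    fix k assume "k < l \<and> 0 < \<gamma> k"
    with that(3)[of k] show "i \<le> k" by (cases "k < i") auto
  qed (use that in auto)
  have gopC: "gop n i (C i)" if "i \<le> l" for i
    using gcomm_chain_gop[OF chain gop that] .
  have w_low: "low n (Suc p) (w \<gamma>)" if \<gamma>: "weight l \<gamma> = Suc j" for \<gamma>
  proof (cases "\<exists>i<l. 0 < \<gamma> i")
    case True
    define i where "i = fst_ix \<gamma>"
    have i: "i < l" "0 < \<gamma> i"
      using fst_ix[OF True] by (auto simp: i_def)
    then have "low n p (v (\<gamma>(i := \<gamma> i - 1)))"
      using \<gamma> weight_dec_upd[of i l \<gamma>] by (intro v) simp
    then have "low n (p - i + Suc i) (C (Suc i) (As n f i (v (\<gamma>(i := \<gamma> i - 1)))))"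
      using i by (intro gop_low[OF gopC] low_As) auto
    then have "low n (Suc p) (C (Suc i) (As n f i (v (\<gamma>(i := \<gamma> i - 1)))))"
      by (rule low_mono) simp
    with True show ?thesis
      by (simp add: w_def low_scl flip: i_def)
  qed (simp only: w_def if_False low_zero)
  have w_le: "w (\<alpha>(k := Suc (\<alpha> k))) = scl (tri k) (C (Suc k) (As n f k (v \<alpha>)))"
    if "k < l" "\<And>i. i < k \<Longrightarrow> \<alpha> i = 0" for \<alpha> k
  proof -
    have "fst_ix (\<alpha>(k := Suc (\<alpha> k))) = k"
      using that by (intro fst_ixI) auto
    moreover have "\<exists>i<l. 0 < (\<alpha>(k := Suc (\<alpha> k))) i"
      using that by auto
    ultimately show ?thesis
      by (simp add: w_def Let_def)
  qed
  have main: "vanishes_mod J (bd n f l w \<alpha> - C 0 (v \<alpha>))" if \<alpha>: "weight l \<alpha> = j" for \<alpha>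
  proof (cases "\<exists>i<l. 0 < \<alpha> i")
    case False
    \<comment> \<open>In weight 0 all \<open>l\<close> summands belong to the telescoping formula.
      Its remainder contains the splice map at \<open>v \<alpha>\<close>, which vanishes modulo
      \<open>J\<close>.\<close>
    have "bd n f l w \<alpha> = (\<Sum>k<l. ctr n (f k) (scl (tri k) (C (Suc k) (As n f k (v \<alpha>)))))"
      unfolding bd_def
      by (intro sum.cong refl arg_cong[where f = "ctr n (f _)"] w_le) (use False in auto)
    then have "bd n f l w \<alpha> - C 0 (v \<alpha>) = - scl (tri l) (C l (As n f l (v \<alpha>)))"
      using gcomm_chain_telescope[OF chain order_refl, of "v \<alpha>"] by simp
    moreover have "weight l \<alpha> = 0"
      using False by (simp add: weight_def)
    then have "vanishes_mod J (As n f l (v \<alpha>))"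
      using cyc \<alpha> by (simp add: cycle_def)
    ultimately show ?thesis
      using gop_vanishes_mod[OF gop J] by (simp add: vanishes_mod_uminus[OF J] vanishes_mod_scl[OF J])
  next
    case True
    \<comment> \<open>Raising an exponent at \<open>k \<le> i\<close> makes \<open>k\<close> the
      first index and yields telescoping summands. Raising one at \<open>k > i\<close> keeps
      \<open>i\<close> first, and there \<open>C'\<close> commutes with the contraction up to sign.
      The remainder is assembled into the boundary of \<open>v\<close> at \<beta>.\<close>
    define i where "i = fst_ix \<alpha>"
    have i: "i < l" "0 < \<alpha> i" "\<And>k. k < i \<Longrightarrow> \<alpha> k = 0"
      using fst_ix[OF True] by (auto simp: i_def)
    define \<beta> where "\<beta> = \<alpha>(i := \<alpha> i - 1)"
    define V where "V k = v (\<beta>(k := Suc (\<beta> k)))" for k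
    have Vi: "V i = v \<alpha>"
      using i by (simp add: V_def \<beta>_def)
    define C' where "C' = C (Suc i)"
    have linC': "lin C'"
      unfolding C'_def using i by (intro gop_lin[OF gopC]) simp
    have sgn: "scl (tri i) (scl ((- 1) ^ Suc i) (C' (scl ((- 1) ^ i) u))) = - scl (tri i) (C' u)" for u
      by (simp add: lin_scl[OF linC'] neg_one_power_sq mult.assoc)
    have w_gt: "w (\<alpha>(k := Suc (\<alpha> k))) = scl (tri i) (C' (As n f i (V k)))"
      if "i < k" for k
    proof -
      have "fst_ix (\<alpha>(k := Suc (\<alpha> k))) = i"
        using that i by (intro fst_ixI) auto
      moreover have "\<exists>i<l. 0 < (\<alpha>(k := Suc (\<alpha> k))) i"
        using i that by (intro exI[of _ i]) auto
      moreover have "(\<alpha>(k := Suc (\<alpha> k), i := \<alpha> i - 1)) = \<beta>(k := Suc (\<beta> k))"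
        using that unfolding \<beta>_def by (simp add: fun_upd_twist)
      ultimately show ?thesis
        using that by (simp add: w_def Let_def V_def C'_def)
    qed
    have split: "(\<Sum>k<l. h k) = (\<Sum>k<Suc i. h k) + (\<Sum>k\<in>{Suc i..<l}. h k)" for h :: "nat \<Rightarrow> 'a ext"
    proof -
      have "sum h {..<l} = sum h ({..<Suc i} \<union> {Suc i..<l})"
        using i(1) by (intro sum.cong) auto
      also have "\<dots> = sum h {..<Suc i} + sum h {Suc i..<l}"
        by (rule sum.union_disjoint) auto
      finally show ?thesis .
    qed
    define R where "R = (\<Sum>k\<in>{Suc i..<l}. ctr n (f k) (V k))"
    have "(\<Sum>k\<in>{Suc i..<l}. ctr n (f k) (w (\<alpha>(k := Suc (\<alpha> k)))))
        = (\<Sum>k\<in>{Suc i..<l}. - scl (tri i) (C' (As n f i (ctr n (f k) (V k)))))"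
    proof (intro sum.cong refl)
      fix k assume k: "k \<in> {Suc i..<l}"
      have "ctr n (f k) (w (\<alpha>(k := Suc (\<alpha> k)))) = scl (tri i) (ctr n (f k) (C' (As n f i (V k))))"
        using k by (simp add: w_gt lin_scl[OF lin_ctr])
      also have "ctr n (f k) (C' (As n f i (V k)))
          = scl ((- 1) ^ Suc i) (C' (ctr n (f k) (As n f i (V k))))"
        unfolding C'_def using k by (intro gcomm_chain_commute[OF chain gop]) auto
      also have "ctr n (f k) (As n f i (V k)) = scl ((- 1) ^ i) (As n f i (ctr n (f k) (V k)))"
        by (rule ctr_As)
      finally show "ctr n (f k) (w (\<alpha>(k := Suc (\<alpha> k))))
          = - scl (tri i) (C' (As n f i (ctr n (f k) (V k))))"
        by (simp only: sgn)
    qed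
    also have "\<dots> = - scl (tri i) (C' (As n f i R))"
      unfolding R_def lin_sum[OF lin_As] lin_sum[OF linC'] scl_sum by (simp add: sum_negf)
    finally have upper: "(\<Sum>k\<in>{Suc i..<l}. ctr n (f k) (w (\<alpha>(k := Suc (\<alpha> k)))))
        = - scl (tri i) (C' (As n f i R))" .
    have "(\<Sum>k<Suc i. ctr n (f k) (w (\<alpha>(k := Suc (\<alpha> k)))))
        = (\<Sum>k<Suc i. ctr n (f k) (scl (tri k) (C (Suc k) (As n f k (v \<alpha>)))))"
    proof (intro sum.cong refl arg_cong[where f = "ctr n (f _)"] w_le)
      fix k i' assume "k \<in> {..<Suc i}" "i' < k"
      then show "\<alpha> i' = 0" by (intro i(3)) auto
    qed (use i in auto)
    also have "\<dots> = C 0 (v \<alpha>) - scl (tri (Suc i)) (C' (As n f (Suc i) (v \<alpha>)))"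
      using gcomm_chain_telescope[OF chain, of "Suc i" "v \<alpha>"] i(1) by (simp add: C'_def)
    finally have total: "bd n f l w \<alpha> - C 0 (v \<alpha>)
        = - scl (tri (Suc i)) (C' (As n f (Suc i) (v \<alpha>))) - scl (tri i) (C' (As n f i R))"
      unfolding bd_def split upper by simp
    have "bd n f l v \<beta> = (\<Sum>k<i. ctr n (f k) (V k)) + ctr n (f i) (v \<alpha>) + R"
      unfolding bd_def split R_def V_def[symmetric] by (simp add: Vi)
    \<comment> \<open>The contractions by forms before \<open>i\<close> are killed by
      \<open>As n f i\<close>, so the lower part of the boundary drops out.\<close>
    then have "As n f i (bd n f l v \<beta>) = As n f i (ctr n (f i) (v \<alpha>)) + As n f i R"
      by (simp add: lin_add[OF lin_As] lin_sum[OF lin_As] As_ctr_eq_0)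
    moreover have "As n f i (ctr n (f i) (v \<alpha>)) = scl ((- 1) ^ i) (As n f (Suc i) (v \<alpha>))"
      by (simp add: ctr_As neg_one_power_sq)
    ultimately have "As n f i R = As n f i (bd n f l v \<beta>) - scl ((- 1) ^ i) (As n f (Suc i) (v \<alpha>))"
      by simp
    then have "scl (tri i) (C' (As n f i R))
        = scl (tri i) (C' (As n f i (bd n f l v \<beta>))) - scl (tri (Suc i)) (C' (As n f (Suc i) (v \<alpha>)))"
      by (simp only: lin_diff[OF linC'] lin_scl[OF linC'] scl_diff) (simp add: mult.commute)
    with total have "bd n f l w \<alpha> - C 0 (v \<alpha>) = - scl (tri i) (C' (As n f i (bd n f l v \<beta>)))"
      by simp
    moreover have "vanishes_mod J (bd n f l v \<beta>)"
    proof -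
      have "Suc (weight l \<beta>) = j"
        using weight_dec_upd[of i l \<alpha>] i \<alpha> by (simp add: \<beta>_def)
      with cyc show ?thesis by (simp add: cycle_def)
    qed
    then have "vanishes_mod J (C' (As n f i (bd n f l v \<beta>)))"
      unfolding C'_def using i by (intro gop_vanishes_mod[OF gopC] vanishes_mod_As J) auto
    ultimately show ?thesis
      by (simp add: vanishes_mod_uminus[OF J] vanishes_mod_scl[OF J])
  qed
  from w_low main show ?thesis by blast
qed

subsection \<open>Minors and exactness\<close>

text \<open>Contracting e_K with all forms leaves a scalar; for \<open>card K = l\<close> it is the
  minor with columns \<open>K\<close> up to the sign \<open>tri l\<close>. In this form the minors
  are the coordinates of the wedge product of the forms.\<close>

definition minor :: "nat \<Rightarrow> (nat \<Rightarrow> nat \<Rightarrow> 'a) \<Rightarrow> nat \<Rightarrow> 'a::comm_ring_1 ext" where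
  "minor n f l K = Fs n f l (bas K) {}"

definition mideal :: "nat \<Rightarrow> (nat \<Rightarrow> nat \<Rightarrow> 'a) \<Rightarrow> nat \<Rightarrow> 'a::comm_ring_1 set" where
  "mideal n f l = ideal_gen {minor n f l K | K. K \<subseteq> {..<n} \<and> card K = l}"

definition unit_vec_fun :: "nat \<Rightarrow> nat \<Rightarrow> 'a::comm_ring_1" where
  "unit_vec_fun j = (\<lambda>i. if i = j then 1 else 0)"

lemma is_ideal_mideal: "is_ideal (mideal n f l)"
  unfolding mideal_def by (rule is_ideal_gen)

lemma minor_in_mideal: "K \<subseteq> {..<n} \<Longrightarrow> card K = l \<Longrightarrow> minor n f l K \<in> mideal n f l"
  unfolding mideal_def by (rule subsetD[OF ideal_gen_superset]) auto

lemma wdg_unit: "j < n \<Longrightarrow> wdg n (unit_vec_fun j) u = eps j u"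
proof -
  assume "j < n"
  have "wdg n (unit_vec_fun j) u = (\<Sum>i<n. if i = j then eps j u else 0)"
    unfolding wdg_def unit_vec_fun_def by (intro sum.cong refl) simp
  with \<open>j < n\<close> show ?thesis by simp
qed

lemma pairing_unit: "j < n \<Longrightarrow> pairing n f (unit_vec_fun j) = f j"
proof -
  assume "j < n"
  have "pairing n f (unit_vec_fun j) = (\<Sum>i<n. if i = j then f j else 0)"
    unfolding pairing_def unit_vec_fun_def by (intro sum.cong refl) simp
  with \<open>j < n\<close> show ?thesis by simp
qed

lemma eps_bas: "(\<And>i. i \<in> K \<Longrightarrow> j < i) \<Longrightarrow> eps j (bas K) = bas (insert j K)"
proof
  fix S assume K: "\<And>i. i \<in> K \<Longrightarrow> j < i"
  then have "j \<notin> K" by blast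
  have "sg j (insert j K) = (1::'a)"
  proof -
    have "{i \<in> insert j K. i < j} = {}" using K by fastforce
    then show ?thesis unfolding sg_def by (simp only: card.empty power_0)
  qed
  moreover have "j \<in> S \<and> S - {j} = K \<longleftrightarrow> S = insert j K"
    using \<open>j \<notin> K\<close> by auto
  ultimately show "eps j (bas K) S = (bas (insert j K) S :: 'a)"
    by (auto simp: eps_def bas_def)
qed

lemma Es_units:
  assumes "\<And>i k. i < k \<Longrightarrow> k < l \<Longrightarrow> h i < h k" "\<And>i. i < l \<Longrightarrow> h i < n"
  shows "Es n (\<lambda>i. unit_vec_fun (h i)) l (bas {}) = (bas (h ` {..<l}) :: 'a::comm_ring_1 ext)"
  using assms
proof (induction l arbitrary: h)
  case (Suc l)
  have "Es n (\<lambda>i. unit_vec_fun (h (Suc i))) l (bas {}) = (bas ((\<lambda>i. h (Suc i)) ` {..<l}) :: 'a ext)"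
    by (rule Suc.IH[of "\<lambda>i. h (Suc i)"]) (auto intro: Suc.prems)
  moreover have "h ` {..<Suc l} = insert (h 0) ((\<lambda>i. h (Suc i)) ` {..<l})"
    unfolding lessThan_Suc_eq_insert_0 by (simp add: image_image)
  ultimately show ?case
    using Suc.prems by (auto simp: wdg_unit intro!: eps_bas)
qed simp

lemma ctr_bas_empty: "ctr n f (bas {}) = 0"
proof -
  have "iota j (bas {}) = (0 :: 'a ext)" for j
    by (auto simp: iota_def bas_def fun_eq_iff pointwise)
  then show ?thesis by (simp add: ctr_def)
qed

text \<open>In each commutator the term in which the contraction acts first vanishes at
  \<open>z\<close>.\<close>

lemma gcomms_eq_Fs:
  assumes "gop n l X" "\<And>k. k < l \<Longrightarrow> ctr n (f k) z = 0"
  shows "gcomms n f l X z = Fs n f l (X z)"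
  using assms
proof (induction l arbitrary: X)
  case (Suc l)
  have "gcomms n f (Suc l) X z = Fs n f l (gcomm n (f l) (Suc l) X z)"
    using Suc.IH[OF gop_gcomm[OF Suc.prems(1)]] Suc.prems(2) by simp
  moreover have "gcomm n (f l) (Suc l) X z = ctr n (f l) (X z)"
    using Suc.prems(2)[of l] by (simp add: gcomm_def lin_zero[OF gop_lin[OF Suc.prems(1)]])
  ultimately show ?case by simp
qed simp

lemma pick_mono:
  assumes "K \<subseteq> {..<n}" "i < k" "k < card K"
  shows "pick K i < pick K k"
proof -
  have "finite K" using assms(1) finite_subset by blast
  then show ?thesis using assms pick_mono_le by blast
qed

lemma pick_less: "K \<subseteq> {..<n} \<Longrightarrow> i < card K \<Longrightarrow> pick K i < n"
  using pick_in_set_le[of i K] by auto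

lemma pick_image:
  assumes "K \<subseteq> {..<n}"
  shows "pick K ` {..<card K} = K"
proof -
  have fin: "finite K" using assms finite_subset by blast
  have "inj_on (pick K) {..<card K}"
    by (rule linorder_inj_onI) (use pick_mono[OF assms] in fastforce)+
  then have "card (pick K ` {..<card K}) = card K"
    by (simp add: card_image)
  moreover have "pick K ` {..<card K} \<subseteq> K"
    using pick_in_set_le by auto
  ultimately show ?thesis using fin by (intro card_subset_eq) auto
qed

lemma Es_pick:
  assumes "K \<subseteq> {..<n}" "card K = l"
  shows "Es n (\<lambda>i. unit_vec_fun (pick K i)) l (bas {}) = (bas K :: 'a::comm_ring_1 ext)"
proof -
  have "Es n (\<lambda>i. unit_vec_fun (pick K i)) l (bas {}) = (bas (pick K ` {..<l}) :: 'a ext)"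
    using assms(2) pick_mono[OF assms(1)] pick_less[OF assms(1)] by (intro Es_units) auto
  with pick_image[OF assms(1)] assms(2) show ?thesis by simp
qed

text \<open>Applies the iterated commutator of multiplication by e_K to the unit
  \<open>bas {}\<close> in two ways: it is a scalar by \<open>gcomms_Es\<close>, and it is the
  contraction of e_K because contractions kill the unit.\<close>

lemma det_pick:
  assumes "K \<subseteq> {..<n}" "card K = l"
  shows "det (mat l l (\<lambda>(i, j). f i (pick K j))) = tri l * minor n f l K"
proof -
  let ?g = "\<lambda>i. unit_vec_fun (pick K i)"
  have "mat l l (\<lambda>(i, j). pairing n (f i) (?g j)) = mat l l (\<lambda>(i, j). f i (pick K j))"
    using assms(2) pick_less[OF assms(1)] by (intro eq_matI) (auto simp: pairing_unit)
  moreover have "gcomms n f l (Es n ?g l) (bas {}) = Fs n f l (bas K)"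
    by (simp only: gcomms_eq_Fs[OF gop_Es ctr_bas_empty] Es_pick[OF assms])
  ultimately have "Fs n f l (bas K) = scl (tri l * det (mat l l (\<lambda>(i, j). f i (pick K j)))) (bas {})"
    using gcomms_Es[of n f l ?g "bas {}"] by simp
  then have "minor n f l K = tri l * det (mat l l (\<lambda>(i, j). f i (pick K j)))"
    unfolding minor_def by (simp add: scl_apply) (simp add: bas_def)
  then show ?thesis by (simp add: tri_sq_left)
qed

lemma gcomms_minor:
  assumes "K \<subseteq> {..<n}" "card K = l"
  shows "gcomms n f l (Es n (\<lambda>i. unit_vec_fun (pick K i)) l) u = scl (minor n f l K) u"
proof -
  have "mat l l (\<lambda>(i, j). pairing n (f i) (unit_vec_fun (pick K j))) = mat l l (\<lambda>(i, j). f i (pick K j))"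
    using assms(2) pick_less[OF assms(1)] by (intro eq_matI) (auto simp: pairing_unit)
  with det_pick[OF assms, of f] show ?thesis
    by (simp add: gcomms_Es tri_sq_left)
qed

section \<open>Annihilation of homology by minors, and exactness\<close>

lemma bd_add: "bd n f l (\<lambda>\<gamma>. u \<gamma> + v \<gamma>) \<alpha> = bd n f l u \<alpha> + bd n f l v \<alpha>"
  unfolding bd_def by (simp add: lin_add[OF lin_ctr] sum.distrib)

lemma bd_scl: "bd n f l (\<lambda>\<gamma>. scl a (u \<gamma>)) \<alpha> = scl a (bd n f l u \<alpha>)"
  unfolding bd_def by (simp add: lin_scl[OF lin_ctr] scl_sum)

lemma bd_zero: "bd n f l (\<lambda>\<gamma>. 0) \<alpha> = 0"
  unfolding bd_def by (simp add: lin_zero[OF lin_ctr])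

lemma bd_bd: "bd n f l (bd n f l x) \<alpha> = 0"
  unfolding bd_def[of n f l "bd n f l x"] unfolding bd_def[of n f l x] lin_sum[OF lin_ctr]
proof (rule sum_antisymmetric)
  fix j k
  have "\<alpha>(j := Suc (\<alpha> j), k := Suc ((\<alpha>(j := Suc (\<alpha> j))) k))
      = \<alpha>(k := Suc (\<alpha> k), j := Suc ((\<alpha>(k := Suc (\<alpha> k))) j))"
    by (cases "j = k") (auto simp: fun_upd_twist)
  then show "ctr n (f j) (ctr n (f k) (x (\<alpha>(j := Suc (\<alpha> j), k := Suc ((\<alpha>(j := Suc (\<alpha> j))) k)))))
      = - ctr n (f k) (ctr n (f j) (x (\<alpha>(k := Suc (\<alpha> k), j := Suc ((\<alpha>(k := Suc (\<alpha> k))) j)))))"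
    by (simp only: ctr_anticomm[of n "f j"])
qed simp

text \<open>The elements \<open>a\<close> that admit such a \<open>w\<close> form an ideal. It
  contains the minors, because the chain that starts with multiplication by e_K ends with
  multiplication by the minor at \<open>K\<close>.\<close>

lemma mideal_homotopy:
  fixes f :: "nat \<Rightarrow> nat \<Rightarrow> 'a::comm_ring_1"
  assumes J: "is_ideal J" and a: "a \<in> mideal n f l"
    and v: "\<And>\<alpha>. weight l \<alpha> = j \<Longrightarrow> low n p (v \<alpha>)" and cyc: "cycle n f l J j v"
  shows "\<exists>w. (\<forall>\<gamma>. weight l \<gamma> = Suc j \<longrightarrow> low n (Suc p) (w \<gamma>)) \<and>
    (\<forall>\<alpha>. weight l \<alpha> = j \<longrightarrow> vanishes_mod J (bd n f l w \<alpha> - scl a (v \<alpha>)))"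
proof -
  define P where "P a w \<longleftrightarrow> (\<forall>\<gamma>. weight l \<gamma> = Suc j \<longrightarrow> low n (Suc p) (w \<gamma>)) \<and>
    (\<forall>\<alpha>. weight l \<alpha> = j \<longrightarrow> vanishes_mod J (bd n f l w \<alpha> - scl a (v \<alpha>)))" for a w
  have "is_ideal {a. \<exists>w. P a w}"
    unfolding is_ideal_def
  proof (intro conjI ballI allI)
    have "P 0 (\<lambda>_. 0)"
      unfolding P_def by (simp add: bd_zero vanishes_mod_zero[OF J])
    then show "0 \<in> {a. \<exists>w. P a w}" by blast
  next
    fix a b assume "a \<in> {a. \<exists>w. P a w}" "b \<in> {a. \<exists>w. P a w}"
    then obtain w x where wx: "P a w" "P b x" by auto
    have "vanishes_mod J (bd n f l (\<lambda>\<gamma>. w \<gamma> + x \<gamma>) \<alpha> - scl (a + b) (v \<alpha>))"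
      if "weight l \<alpha> = j" for \<alpha>
    proof -
      have "vanishes_mod J ((bd n f l w \<alpha> - scl a (v \<alpha>)) + (bd n f l x \<alpha> - scl b (v \<alpha>)))"
        using wx that unfolding P_def by (intro vanishes_mod_add J) auto
      then show ?thesis by (simp add: bd_add scl_add_left algebra_simps)
    qed
    with wx have "P (a + b) (\<lambda>\<gamma>. w \<gamma> + x \<gamma>)"
      unfolding P_def by (simp add: low_add)
    then show "a + b \<in> {a. \<exists>w. P a w}" by blast
  next
    fix r a assume "a \<in> {a. \<exists>w. P a w}"
    then obtain w where w: "P a w" by auto
    have "vanishes_mod J (bd n f l (\<lambda>\<gamma>. scl r (w \<gamma>)) \<alpha> - scl (r * a) (v \<alpha>))"
      if "weight l \<alpha> = j" for \<alpha>
    proof -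
      have "vanishes_mod J (scl r (bd n f l w \<alpha> - scl a (v \<alpha>)))"
        using w that unfolding P_def by (intro vanishes_mod_scl J) auto
      then show ?thesis by (simp add: bd_scl scl_diff)
    qed
    with w have "P (r * a) (\<lambda>\<gamma>. scl r (w \<gamma>))"
      unfolding P_def by (simp add: low_scl)
    then show "r * a \<in> {a. \<exists>w. P a w}" by blast
  qed
  moreover have "minor n f l K \<in> {a. \<exists>w. P a w}" if K: "K \<subseteq> {..<n}" "card K = l" for K
  proof -
    let ?X = "Es n (\<lambda>i. unit_vec_fun (pick K i)) l"
    obtain C where C: "C l = ?X" "C 0 = gcomms n f l ?X"
      "\<forall>i<l. C i = gcomm n (f i) (Suc i) (C (Suc i))"
      using gcomm_chain[of l ?X n f] by auto
    have "gop n l (C l)"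
      unfolding C(1) by (rule gop_Es)
    from cycle_homotopy[OF J C(3) this v cyc] have "\<exists>w. P (minor n f l K) w"
      unfolding P_def C(2) gcomms_minor[OF K] by simp
    then show ?thesis by blast
  qed
  ultimately have "mideal n f l \<subseteq> {a. \<exists>w. P a w}"
    unfolding mideal_def by (intro ideal_gen_least) auto
  with a show ?thesis unfolding P_def by blast
qed

text \<open>The same annihilation at the target of the splice map. For the minor at \<open>K\<close>
  the witness is the wedge of e_K with \<open>z\<close>.\<close>

lemma mideal_homotopy_Fs:
  fixes f :: "nat \<Rightarrow> nat \<Rightarrow> 'a::comm_ring_1"
  assumes a: "a \<in> mideal n f l" and z: "low n p z" "\<And>k. k < l \<Longrightarrow> ctr n (f k) z = 0"
  shows "\<exists>w. low n (p + l) w \<and> Fs n f l w = scl a z"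
proof -
  let ?I = "{a. \<exists>w. low n (p + l) w \<and> Fs n f l w = scl a z}"
  have "is_ideal ?I"
    unfolding is_ideal_def
  proof (intro conjI ballI allI)
    show "0 \<in> ?I"
      by (auto intro: exI[of _ 0] simp: lin_zero[OF lin_Fs])
  next
    fix a b assume "a \<in> ?I" "b \<in> ?I"
    then obtain w x where "low n (p + l) w" "Fs n f l w = scl a z"
      "low n (p + l) x" "Fs n f l x = scl b z" by auto
    then show "a + b \<in> ?I"
      by (auto intro!: exI[of _ "w + x"] simp: lin_add[OF lin_Fs] scl_add_left low_add)
  next
    fix r a assume "a \<in> ?I"
    then obtain w where "low n (p + l) w" "Fs n f l w = scl a z" by auto
    then show "r * a \<in> ?I"
      by (auto intro!: exI[of _ "scl r w"] simp: lin_scl[OF lin_Fs] low_scl)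
  qed
  moreover have "minor n f l K \<in> ?I" if K: "K \<subseteq> {..<n}" "card K = l" for K
  proof -
    let ?X = "Es n (\<lambda>i. unit_vec_fun (pick K i)) l"
    have "Fs n f l (?X z) = scl (minor n f l K) z"
      unfolding gcomms_minor[OF K, symmetric]
      by (rule gcomms_eq_Fs[symmetric]) (use gop_Es z(2) in auto)
    with gop_low[OF gop_Es z(1)] show ?thesis by blast
  qed
  ultimately have "mideal n f l \<subseteq> ?I"
    unfolding mideal_def by (intro ideal_gen_least) auto
  with a show ?thesis by blast
qed

lemma vanishes_mod_insertE:
  assumes "vanishes_mod (ideal_gen (insert a S)) u" "low n p u"
  obtains y where "low n p y" "vanishes_mod (ideal_gen S) (u - scl a y)"
proof -
  have "\<exists>y. u A - a * y \<in> ideal_gen S" for A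
    using assms(1) ideal_gen_insertE unfolding vanishes_mod_def by metis
  then obtain y where y: "\<And>A. u A - a * y A \<in> ideal_gen S" by metis
  \<comment> \<open>Quotients of zero coordinates are set to 0, so that the degree bound carries
    over from \<open>u\<close>.\<close>
  define y' where "y' A = (if u A = 0 then 0 else y A)" for A
  have "low n p y'"
    using assms(2) unfolding low_def y'_def by auto
  moreover have "vanishes_mod (ideal_gen S) (u - scl a y')"
    using y is_ideal_zero[OF is_ideal_gen]
    unfolding vanishes_mod_def y'_def scl_def by (auto simp: pointwise)
  ultimately show thesis by (rule that)
qed

lemma vanishes_mod_cancel:
  assumes "regular_seq I xs" "k < length xs"
    "vanishes_mod (ideal_gen (set (take k xs))) (scl (xs ! k) u)"
  shows "vanishes_mod (ideal_gen (set (take k xs))) u"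
  using assms unfolding regular_seq_def vanishes_mod_def scl_def by blast

text \<open>Acyclicity of the Eagon-Northcott type complexes: the homotopy makes \<open>a \<in> I\<close> annihilate
  the homology, so one may pass to the quotient by a regular element of \<open>I\<close> while moving one step
  towards the end of the complex.\<close>

lemma divided_power_exact:
  fixes f :: "nat \<Rightarrow> nat \<Rightarrow> 'a::comm_ring_1"
  assumes reg: "regular_seq (mideal n f l) xs"
  assumes "n < p + d" "k + d \<le> length xs"
    and v: "\<And>\<alpha>. weight l \<alpha> = j \<Longrightarrow> low n p (v \<alpha>)"
    and cyc: "cycle n f l (ideal_gen (set (take k xs))) j v"
  shows "\<exists>w. (\<forall>\<gamma>. weight l \<gamma> = Suc j \<longrightarrow> low n (Suc p) (w \<gamma>)) \<and>
    (\<forall>\<alpha>. weight l \<alpha> = j \<longrightarrow>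
      vanishes_mod (ideal_gen (set (take k xs))) (bd n f l w \<alpha> - v \<alpha>))"
  using assms(2-)
proof (induction d arbitrary: p k j v)
  case 0
  \<comment> \<open>With \<open>d = 0\<close> the degree bound \<open>p\<close> exceeds
    \<open>n\<close>.\<close>
  then have "v \<alpha> = 0" if "weight l \<alpha> = j" for \<alpha>
    using that low_eq_0[of n p "v \<alpha>"] by simp
  then show ?case
    by (intro exI[of _ "\<lambda>_. 0"]) (simp add: bd_zero vanishes_mod_zero[OF is_ideal_gen])
next
  case (Suc d)
  define a where "a = xs ! k"
  define J where "J = ideal_gen (set (take k xs))"
  define J' where "J' = ideal_gen (set (take (Suc k) xs))"
  have k: "k < length xs" using Suc.prems by simp
  have J: "is_ideal J" and J': "is_ideal J'"
    unfolding J_def J'_def by (rule is_ideal_gen)+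
  have take: "set (take (Suc k) xs) = insert a (set (take k xs))"
    using k by (simp add: a_def take_Suc_conv_app_nth)
  have "a \<in> J'"
    unfolding J'_def take using ideal_gen_superset by blast
  have "J \<subseteq> J'"
    unfolding J_def by (rule ideal_gen_least[OF J']) (use take ideal_gen_superset J'_def in blast)
  have "a \<in> mideal n f l"
    using reg nth_mem[OF k] unfolding regular_seq_def a_def by blast
  from mideal_homotopy[OF J this Suc.prems(3) Suc.prems(4)[folded J_def]] obtain w where
    w_low: "\<And>\<gamma>. weight l \<gamma> = Suc j \<Longrightarrow> low n (Suc p) (w \<gamma>)" and
    w: "\<And>\<alpha>. weight l \<alpha> = j \<Longrightarrow> vanishes_mod J (bd n f l w \<alpha> - scl a (v \<alpha>))"
    by blast
  have "vanishes_mod J' (bd n f l w \<beta>)" if "weight l \<beta> = j" for \<beta>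
  proof -
    have "vanishes_mod J' (bd n f l w \<beta> - scl a (v \<beta>))"
      using w[OF that] \<open>J \<subseteq> J'\<close> by (auto simp: vanishes_mod_def)
    moreover have "vanishes_mod J' (scl a (v \<beta>))"
      using \<open>a \<in> J'\<close> by (simp add: vanishes_mod_def scl_def is_ideal_mult_right[OF J'])
    ultimately have "vanishes_mod J' ((bd n f l w \<beta> - scl a (v \<beta>)) + scl a (v \<beta>))"
      by (rule vanishes_mod_add[OF J'])
    then show ?thesis by simp
  qed
  \<comment> \<open>The boundary of \<open>w\<close> is \<open>a\<close> times \<open>v\<close>
    modulo \<open>J\<close>, so \<open>w\<close> is a cycle modulo \<open>J'\<close>. The induction
    hypothesis applies with \<open>p\<close>, \<open>k\<close> and \<open>j\<close> raised and
    \<open>d\<close> lowered by one.\<close>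
  then have "cycle n f l J' (Suc j) w"
    by (simp add: cycle_def)
  then obtain x where
    x_low: "\<And>\<gamma>. weight l \<gamma> = Suc (Suc j) \<Longrightarrow> low n (Suc (Suc p)) (x \<gamma>)" and
    x: "\<And>\<alpha>. weight l \<alpha> = Suc j \<Longrightarrow> vanishes_mod J' (bd n f l x \<alpha> - w \<alpha>)"
    using Suc.IH[of "Suc p" "Suc k" "Suc j" w] Suc.prems(1,2) w_low unfolding J'_def by auto
  have "\<exists>y. low n (Suc p) y \<and> vanishes_mod J (w \<gamma> - bd n f l x \<gamma> - scl a y)"
    if "weight l \<gamma> = Suc j" for \<gamma>
  proof -
    have "low n (Suc p) (w \<gamma> - bd n f l x \<gamma>)"
      using w_low that x_low by (intro low_diff low_bd) auto
    moreover have "vanishes_mod J' (w \<gamma> - bd n f l x \<gamma>)"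
      using vanishes_mod_uminus[OF J' x[OF that]] by simp
    ultimately show ?thesis
      unfolding J'_def take J_def by (metis vanishes_mod_insertE)
  qed
  then obtain y where
    y_low: "\<And>\<gamma>. weight l \<gamma> = Suc j \<Longrightarrow> low n (Suc p) (y \<gamma>)" and
    y: "\<And>\<gamma>. weight l \<gamma> = Suc j \<Longrightarrow> vanishes_mod J (w \<gamma> - bd n f l x \<gamma> - scl a (y \<gamma>))"
    by metis
  \<comment> \<open>Thus \<open>w\<close> is a boundary plus \<open>a\<close> times \<open>y\<close>
    plus an error in \<open>J\<close>. Applying \<open>bd\<close> removes the boundary and leaves
    \<open>a\<close> times the claim, from which the regular element \<open>a\<close>
    cancels.\<close>
  define e where "e \<gamma> = w \<gamma> - bd n f l x \<gamma> - scl a (y \<gamma>)" for \<gamma>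
  have "vanishes_mod J (bd n f l y \<alpha> - v \<alpha>)" if \<alpha>: "weight l \<alpha> = j" for \<alpha>
  proof -
    have "w = (\<lambda>\<gamma>. bd n f l x \<gamma> + (scl a (y \<gamma>) + e \<gamma>))"
      unfolding e_def by simp
    then have "bd n f l w \<alpha>
        = bd n f l (\<lambda>\<gamma>. bd n f l x \<gamma> + (scl a (y \<gamma>) + e \<gamma>)) \<alpha>" by simp
    then have "bd n f l w \<alpha> = scl a (bd n f l y \<alpha>) + bd n f l e \<alpha>"
      by (simp only: bd_add bd_bd bd_scl add_0)
    then have "scl a (bd n f l y \<alpha> - v \<alpha>)
        = (bd n f l w \<alpha> - scl a (v \<alpha>)) - bd n f l e \<alpha>"
      by (simp add: scl_diff)
    moreover have "vanishes_mod J (bd n f l e \<alpha>)"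
      unfolding bd_def
    proof (intro vanishes_mod_sum[OF J] vanishes_mod_ctr[OF J])
      fix k assume "k \<in> {..<l}"
      then show "vanishes_mod J (e (\<alpha>(k := Suc (\<alpha> k))))"
        unfolding e_def using \<alpha> by (intro y) (simp add: weight_Suc_upd)
    qed
    ultimately have "vanishes_mod J (scl a (bd n f l y \<alpha> - v \<alpha>))"
      using w[OF \<alpha>] by (simp add: vanishes_mod_diff[OF J])
    then show ?thesis
      unfolding J_def a_def by (rule vanishes_mod_cancel[OF reg k])
  qed
  with y_low show ?case
    unfolding J_def by blast
qed

lemma Fs_ctr_eq_0: "k < l \<Longrightarrow> Fs n f l (ctr n (f k) u) = 0"
  using As_ctr_eq_0[of k l n f u] by (simp add: As_eq_Fs) (metis scl_simps(1,3,4) tri_sq)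

lemma vanishes_mod_trivial: "vanishes_mod (ideal_gen {}) u \<longleftrightarrow> u = 0"
  by (auto simp: vanishes_mod_def ideal_gen_empty fun_eq_iff pointwise)

text \<open>Exactness at the source of the splice map; \<open>Suc n - l\<close> steps lead from
  degree \<open>l\<close> beyond \<open>n\<close>.\<close>

lemma kernel_Fs:
  fixes f :: "nat \<Rightarrow> nat \<Rightarrow> 'a::comm_ring_1"
  assumes reg: "regular_seq (mideal n f l) xs" and len: "Suc n - l \<le> length xs"
    and c: "low n l c" "Fs n f l c = 0"
  shows "\<exists>w. c = (\<Sum>i<l. ctr n (f i) (w i))"
proof -
  have "cycle n f l (ideal_gen (set (take 0 xs))) 0 (\<lambda>_. c)"
    unfolding cycle_def using c(2) by (simp add: As_eq_Fs vanishes_mod_zero[OF is_ideal_gen])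
  moreover have "n < l + (Suc n - l)" "0 + (Suc n - l) \<le> length xs"
    using len by auto
  ultimately obtain w where
    "\<forall>\<alpha>. weight l \<alpha> = 0 \<longrightarrow> vanishes_mod (ideal_gen (set (take 0 xs))) (bd n f l w \<alpha> - c)"
    using divided_power_exact[OF reg, of l "Suc n - l" 0 0 "\<lambda>_. c"] c(1) by blast
  then have "bd n f l w (\<lambda>_. 0) = c"
    by (simp add: vanishes_mod_trivial weight_def)
  then show ?thesis
    unfolding bd_def by metis
qed

text \<open>Exactness at the target of the splice map, at the price of one more regular element
  \<open>a\<close>: \<open>a\<close> times \<open>z\<close> is a full contraction of some
  \<open>w\<close>, which is a cycle modulo \<open>a\<close>, hence a boundary plus \<open>a\<close>
  times \<open>y\<close>. As \<open>Fs\<close> kills boundaries, \<open>a\<close> cancels.\<close>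

lemma common_kernel_ctr:
  fixes f :: "nat \<Rightarrow> nat \<Rightarrow> 'a::comm_ring_1"
  assumes reg: "regular_seq (mideal n f l) xs" and len: "Suc (Suc n - (q + l)) \<le> length xs"
    and z: "low n q z" "\<And>k. k < l \<Longrightarrow> ctr n (f k) z = 0"
  shows "\<exists>y. low n (q + l) y \<and> z = Fs n f l y"
proof -
  define a where "a = xs ! 0"
  have xs: "0 < length xs" using len by linarith
  have take: "set (take (Suc 0) xs) = insert a (set (take 0 xs))"
    using xs by (simp add: a_def take_Suc_conv_app_nth)
  have "a \<in> mideal n f l"
    using reg nth_mem[OF xs] unfolding regular_seq_def a_def by blast
  from mideal_homotopy_Fs[OF this z] obtain w where w: "low n (q + l) w" "Fs n f l w = scl a z"
    by blast
  have "vanishes_mod (ideal_gen (set (take (Suc 0) xs))) (scl a z)"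
    unfolding take using ideal_gen_superset[of "insert a (set (take 0 xs))"]
    by (auto simp: vanishes_mod_def scl_def intro!: is_ideal_mult_right[OF is_ideal_gen])
  then have "vanishes_mod (ideal_gen (set (take (Suc 0) xs))) (As n f l w)"
    unfolding As_eq_Fs w(2) by (rule vanishes_mod_scl[OF is_ideal_gen])
  then have "cycle n f l (ideal_gen (set (take (Suc 0) xs))) 0 (\<lambda>_. w)"
    by (simp add: cycle_def)
  moreover have "n < q + l + (Suc n - (q + l))" "Suc 0 + (Suc n - (q + l)) \<le> length xs"
    using len by auto
  ultimately obtain x where
    x_low: "\<And>\<gamma>. weight l \<gamma> = Suc 0 \<Longrightarrow> low n (Suc (q + l)) (x \<gamma>)" and
    "\<And>\<alpha>. weight l \<alpha> = 0 \<Longrightarrow> vanishes_mod (ideal_gen (set (take (Suc 0) xs))) (bd n f l x \<alpha> - w)"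
    using divided_power_exact[OF reg, of "q + l" "Suc n - (q + l)" "Suc 0" 0 "\<lambda>_. w"] w(1) by blast
  then have x: "vanishes_mod (ideal_gen (set (take (Suc 0) xs))) (bd n f l x (\<lambda>_. 0) - w)"
    by (simp add: weight_def)
  have "vanishes_mod (ideal_gen (insert a (set (take 0 xs)))) (w - bd n f l x (\<lambda>_. 0))"
    using vanishes_mod_uminus[OF is_ideal_gen x] unfolding take by simp
  moreover have "low n (q + l) (w - bd n f l x (\<lambda>_. 0))"
    using x_low w(1) by (intro low_diff low_bd) (auto simp: weight_def)
  ultimately obtain y where y: "low n (q + l) y" "w - bd n f l x (\<lambda>_. 0) - scl a y = 0"
    by (metis vanishes_mod_insertE vanishes_mod_trivial list.set(1) take0)
  have "Fs n f l (bd n f l x (\<lambda>_. 0)) = 0"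
    unfolding bd_def lin_sum[OF lin_Fs] by (simp add: Fs_ctr_eq_0)
  moreover have "w = bd n f l x (\<lambda>_. 0) + scl a y"
    using y(2) by (simp add: algebra_simps)
  ultimately have "Fs n f l w = scl a (Fs n f l y)"
    by (simp add: lin_add[OF lin_Fs] lin_scl[OF lin_Fs])
  then have "scl a (z - Fs n f l y) = 0"
    using w(2) by (simp add: scl_diff)
  then have "vanishes_mod (ideal_gen (set (take 0 xs))) (scl a (z - Fs n f l y))"
    by (simp add: vanishes_mod_trivial)
  then have "vanishes_mod (ideal_gen (set (take 0 xs))) (z - Fs n f l y)"
    unfolding a_def by (rule vanishes_mod_cancel[OF reg xs])
  then have "z = Fs n f l y"
    unfolding take0 list.set vanishes_mod_trivial by (metis eq_iff_diff_eq_0)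
  with y(1) show ?thesis by auto
qed

section \<open>Coordinates of full contractions as combinations of minors\<close>

lemma ctr_apply: "ctr n f u S = (\<Sum>j<n. f j * (if j \<in> S then 0 else sg j S * u (insert j S)))"
  by (simp add: ctr_def sum_fun_apply scl_apply iota_def)

lemma wdg_apply: "wdg n f u S = (\<Sum>j<n. f j * (if j \<in> S then sg j S * u (S - {j}) else 0))"
  by (simp add: wdg_def sum_fun_apply scl_apply eps_def)

text \<open>Every contraction adds one new index to the set at which its argument is read.\<close>

lemma Fs_cong_at:
  assumes "\<And>K. K \<subseteq> {..<n} \<Longrightarrow> K \<inter> S = {} \<Longrightarrow> card K = l \<Longrightarrow> u (S \<union> K) = u' (S \<union> K)"
  shows "Fs n f l u S = Fs n f l u' S"
  using assms
proof (induction l arbitrary: u u')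
  case 0
  from 0[of "{}"] show ?case by simp
next
  case (Suc l)
  have "ctr n (f l) u (S \<union> K) = ctr n (f l) u' (S \<union> K)"
    if K: "K \<subseteq> {..<n}" "K \<inter> S = {}" "card K = l" for K
    unfolding ctr_apply
  proof (intro sum.cong refl)
    fix j assume j: "j \<in> {..<n}"
    have "u (insert j (S \<union> K)) = u' (insert j (S \<union> K))" if "j \<notin> S \<union> K"
    proof -
      have "finite K" using K(1) finite_subset by blast
      then have "u (S \<union> insert j K) = u' (S \<union> insert j K)"
        using j K that by (intro Suc.prems) auto
      then show ?thesis by simp
    qed
    then show "f l j * (if j \<in> S \<union> K then 0 else sg j (S \<union> K) * u (insert j (S \<union> K)))
        = f l j * (if j \<in> S \<union> K then 0 else sg j (S \<union> K) * u' (insert j (S \<union> K)))"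
      by simp
  qed
  then show ?case unfolding Fs.simps by (rule Suc.IH)
qed

lemma Fs_expand:
  "Fs n f l u {} = (\<Sum>K\<in>{K. K \<subseteq> {..<n} \<and> card K = l}. u K * minor n f l K)"
proof -
  let ?A = "{K. K \<subseteq> {..<n} \<and> card K = l}"
  have fin: "finite ?A"
    by (rule finite_subset[of _ "Pow {..<n}"]) auto
  have "Fs n f l u {} = Fs n f l (\<Sum>K\<in>?A. scl (u K) (bas K)) {}"
  proof (rule Fs_cong_at)
    fix K assume "K \<subseteq> {..<n}" "card K = l"
    have "(\<Sum>K'\<in>?A. scl (u K') (bas K')) K = (\<Sum>K'\<in>?A. if K = K' then u K' else 0)"
      unfolding sum_fun_apply scl_apply bas_def by (intro sum.cong) auto
    then show "u ({} \<union> K) = (\<Sum>K'\<in>?A. scl (u K') (bas K')) ({} \<union> K)"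
      using fin \<open>K \<subseteq> {..<n}\<close> \<open>card K = l\<close> by simp
  qed
  also have "\<dots> = (\<Sum>K\<in>?A. u K * minor n f l K)"
    unfolding lin_sum[OF lin_Fs] lin_scl[OF lin_Fs] by (simp add: sum_fun_apply scl_apply minor_def)
  finally show ?thesis .
qed

lemma apply_insert_eq: "j \<notin> S \<Longrightarrow> u (insert j S) = sg j S * iota j u S"
  by (simp add: iota_def)

text \<open>Contracting by the basis forms with index in \<open>S\<close> moves the coordinate to
  the empty set, where \<open>Fs_expand\<close> applies. These contractions commute with
  \<open>Fs\<close> up to sign.\<close>

lemma Fs_in_mideal:
  assumes "finite S"
  shows "Fs n f l u S \<in> mideal n f l"
  using assms
proof (induction S arbitrary: u)
  case empty
  show ?case
    unfolding Fs_expand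
    by (intro is_ideal_sum is_ideal_mult is_ideal_mideal minor_in_mideal) auto
next
  case (insert j S)
  from insert.IH[of "iota j u"] show ?case
    unfolding apply_insert_eq[OF insert.hyps(2)] iota_Fs scl_apply
    by (intro is_ideal_mult is_ideal_mideal)
qed

lemma iota_bas: "iota j (bas S) = (if j \<in> S then scl (sg j S) (bas (S - {j})) else 0)"
proof
  fix T
  have *: "j \<notin> T \<Longrightarrow> insert j T = S \<longleftrightarrow> j \<in> S \<and> T = S - {j}"
    by auto
  show "iota j (bas S) T = (if j \<in> S then scl (sg j S) (bas (S - {j})) else 0) T"
    using * by (cases "j \<in> T") (auto simp: iota_def bas_def scl_apply pointwise sg_remove_ge)
qed

lemma minor_0: "minor n f 0 = bas {}"
  by (auto simp: minor_def bas_def fun_eq_iff)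

lemma minor_Suc: "minor n f (Suc l) = wdg n (f l) (minor n f l)"
proof
  fix S
  have "minor n f (Suc l) S = (\<Sum>j<n. f l j * Fs n f l (iota j (bas S)) {})"
    by (simp add: minor_def ctr_def lin_sum[OF lin_Fs] lin_scl[OF lin_Fs] sum_fun_apply scl_apply)
  also have "\<dots> = wdg n (f l) (minor n f l) S"
    unfolding wdg_apply
    by (intro sum.cong refl)
      (auto simp: iota_bas lin_scl[OF lin_Fs] lin_zero[OF lin_Fs] scl_apply minor_def pointwise)
  finally show "minor n f (Suc l) S = wdg n (f l) (minor n f l) S" .
qed

lemma low_bas_empty: "low n 0 (bas {})"
  by (simp add: low_def bas_def)

lemma low_minor: "low n l (minor n f l)"
  by (induction l) (auto simp: minor_0 minor_Suc low_bas_empty intro: low_wdg)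

lemma ctr_minor_eq_0:
  assumes "\<And>i. i < l \<Longrightarrow> pairing n g (f i) = 0"
  shows "ctr n g (minor n f l) = 0"
  using assms
  by (induction l) (auto simp: minor_0 minor_Suc ctr_bas_empty ctr_wdg lin_zero[OF lin_wdg]
      simp flip: pairing_def)

lemma wdg_bas_empty_singleton: "j < n \<Longrightarrow> wdg n g (bas {}) {j} = g j"
proof -
  assume "j < n"
  have "wdg n g (bas {}) {j} = (\<Sum>i<n. if i = j then g j else 0)"
    unfolding wdg_apply by (intro sum.cong) (auto simp: bas_def sg_insert_ge)
  with \<open>j < n\<close> show ?thesis by simp
qed

lemma pairing_commute: "pairing n f g = pairing n g f"
  by (simp add: pairing_def mult.commute)

text \<open>As an element of degree 1 the vector \<open>g\<close> lies in the common kernel of the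
  contractions. Exactness there makes it a combination of Cramer relations.\<close>

lemma left_kernel_eq_Fs:
  assumes "regular_seq (mideal n f m) xs" "Suc (n - m) \<le> length xs"
    and "\<And>k. k < m \<Longrightarrow> pairing n (f k) g = 0"
  shows "\<exists>a. low n (Suc m) a \<and> wdg n g (bas {}) = Fs n f m a"
proof -
  have "low n 1 (wdg n g (bas {}))"
    using low_wdg[OF low_bas_empty] by simp
  moreover have "ctr n (f k) (wdg n g (bas {})) = 0" if "k < m" for k
    using assms(3)[OF that] unfolding ctr_wdg pairing_def
    by (simp add: ctr_bas_empty lin_zero[OF lin_wdg])
  ultimately show ?thesis
    using common_kernel_ctr[OF assms(1), of 1 "wdg n g (bas {})"] assms(2) by simp
qed

lemma left_kernel_in_mideal:
  assumes "regular_seq (mideal n f m) xs" "Suc (n - m) \<le> length xs"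
    and "\<And>k. k < m \<Longrightarrow> pairing n (f k) g = 0" and "j < n"
  shows "g j \<in> mideal n f m"
proof -
  obtain a where "wdg n g (bas {}) = Fs n f m a"
    using left_kernel_eq_Fs[OF assms(1-3)] by blast
  then have "g j = Fs n f m a {j}"
    using wdg_bas_empty_singleton[OF \<open>j < n\<close>, of g] by simp
  then show ?thesis
    using Fs_in_mideal[of "{j}"] by simp
qed

text \<open>The maximal minors of \<open>f\<close> are the coordinates of the wedge product of the \<open>f k\<close>, which is
  annihilated by the contractions with the \<open>g i\<close>.\<close>

lemma mideal_subset_mideal:
  assumes "regular_seq (mideal n g l) xs" "Suc (Suc n - (m + l)) \<le> length xs"
    and "\<And>i k. i < l \<Longrightarrow> k < m \<Longrightarrow> pairing n (g i) (f k) = 0"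
  shows "mideal n f m \<subseteq> mideal n g l"
proof -
  obtain y where y: "minor n f m = Fs n g l y"
    using common_kernel_ctr[OF assms(1,2) low_minor] ctr_minor_eq_0 assms(3) by metis
  have "minor n f m K \<in> mideal n g l" if "K \<subseteq> {..<n}" for K
    unfolding y using that finite_subset by (intro Fs_in_mideal) blast
  then show ?thesis
    unfolding mideal_def[of n f m] by (intro ideal_gen_least is_ideal_mideal) auto
qed

section \<open>Idempotent ideals\<close>

definition ideal_square :: "'a::comm_ring_1 set \<Rightarrow> 'a set" where
  "ideal_square I = ideal_gen {x * y | x y. x \<in> I \<and> y \<in> I}"

lemma mult_in_ideal_square: "x \<in> I \<Longrightarrow> y \<in> I \<Longrightarrow> x * y \<in> ideal_square I"
  unfolding ideal_square_def by (rule subsetD[OF ideal_gen_superset]) auto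

lemma minor_in_ideal:
  assumes "is_ideal I" "\<And>i j. i < l \<Longrightarrow> j < n \<Longrightarrow> f i j \<in> I" "1 \<le> l"
  shows "minor n f l S \<in> I"
proof -
  obtain l' where l: "l = Suc l'" using assms(3) by (cases l) auto
  show ?thesis
    unfolding l minor_Suc wdg_apply using assms(2)[of l']
    by (intro is_ideal_sum is_ideal_mult_right assms(1)) (auto simp: l)
qed

lemma mideal_subset:
  assumes "is_ideal I" "\<And>i j. i < l \<Longrightarrow> j < n \<Longrightarrow> f i j \<in> I" "1 \<le> l"
  shows "mideal n f l \<subseteq> I"
  unfolding mideal_def using minor_in_ideal[OF assms] by (intro ideal_gen_least assms(1)) auto

text \<open>Expansion along the last row multiplies entries by minors of size \<open>l - 1\<close>,
  and both lie in \<open>I\<close>.\<close>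

lemma mideal_subset_square:
  assumes I: "is_ideal I" and "\<And>i j. i < l \<Longrightarrow> j < n \<Longrightarrow> f i j \<in> I" "2 \<le> l"
  shows "mideal n f l \<subseteq> ideal_square I"
proof -
  obtain l' where l: "l = Suc l'" "1 \<le> l'" using assms(3) by (cases l) auto
  have sq: "is_ideal (ideal_square I)"
    unfolding ideal_square_def by (rule is_ideal_gen)
  have "minor n f l' S \<in> I" for S
    using assms(2) l by (intro minor_in_ideal I) auto
  then have "f l' j * (if j \<in> S then sg j S * minor n f l' (S - {j}) else 0) \<in> ideal_square I"
    if "j < n" for j S
    using that assms(2)[of l' j] l is_ideal_zero[OF sq]
    by (auto intro!: mult_in_ideal_square is_ideal_mult[OF I])
  then have "minor n f l S \<in> ideal_square I" for S
    unfolding l minor_Suc wdg_apply by (intro is_ideal_sum sq) auto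
  then show ?thesis
    unfolding mideal_def by (intro ideal_gen_least sq) auto
qed

text \<open>A Nakayama argument that removes the generators one at a time. Idempotency gives
  \<open>b\<close> in \<open>I\<close> with \<open>(1 - e) * g\<close> congruent to
  \<open>g * b\<close>, and the factor \<open>1 - e - b\<close> then disposes of
  \<open>g\<close>.\<close>

lemma idempotent_ideal_aux:
  fixes I :: "'a::comm_ring_1 set"
  assumes I: "is_ideal I" and sq: "I \<subseteq> ideal_square I"
    and "finite H" "H \<subseteq> I" "e \<in> I" "\<And>x. x \<in> I \<Longrightarrow> (1 - e) * x \<in> ideal_gen H"
  shows "\<exists>e\<in>I. \<forall>x\<in>I. (1 - e) * x = 0"
  using assms(3-)
proof (induction H arbitrary: e)
  case empty
  then show ?case by (auto simp: ideal_gen_empty)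
next
  case (insert g H)
  note H = is_ideal_gen[of H]
  \<comment> \<open>This ideal contains all products of elements of \<open>I\<close>, hence
    \<open>I\<close>, and in particular \<open>g\<close>; that yields \<open>b\<close>.\<close>
  let ?T = "{x. \<exists>b\<in>I. (1 - e) * x - g * b \<in> ideal_gen H}"
  have "is_ideal ?T"
    unfolding is_ideal_def
  proof (intro conjI ballI allI)
    show "0 \<in> ?T"
      using is_ideal_zero[OF I] is_ideal_zero[OF H] by (auto intro: bexI[of _ 0])
  next
    fix x y assume "x \<in> ?T" "y \<in> ?T"
    then obtain b c where bc: "b \<in> I" "c \<in> I" "(1 - e) * x - g * b \<in> ideal_gen H"
      "(1 - e) * y - g * c \<in> ideal_gen H" by auto
    have "(1 - e) * (x + y) - g * (b + c) = ((1 - e) * x - g * b) + ((1 - e) * y - g * c)"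
      by (simp add: algebra_simps)
    with bc show "x + y \<in> ?T"
      using is_ideal_add[OF I] is_ideal_add[OF H] by (auto intro!: bexI[of _ "b + c"])
  next
    fix r x assume "x \<in> ?T"
    then obtain b where b: "b \<in> I" "(1 - e) * x - g * b \<in> ideal_gen H" by auto
    have "(1 - e) * (r * x) - g * (r * b) = r * ((1 - e) * x - g * b)"
      by (simp add: algebra_simps)
    with b show "r * x \<in> ?T"
      using is_ideal_mult[OF I] is_ideal_mult[OF H] by (auto intro!: bexI[of _ "r * b"])
  qed
  moreover have "x * y \<in> ?T" if "x \<in> I" "y \<in> I" for x y
  proof -
    obtain c where c: "(1 - e) * y - g * c \<in> ideal_gen H"
      using ideal_gen_insertE[OF insert.prems(3)[OF \<open>y \<in> I\<close>]] by blast
    have "(1 - e) * (x * y) - g * (x * c) = x * ((1 - e) * y - g * c)"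
      by (simp add: algebra_simps)
    with c \<open>x \<in> I\<close> show ?thesis
      using is_ideal_mult_right[OF I] is_ideal_mult[OF H] by (auto intro!: bexI[of _ "x * c"])
  qed
  ultimately have "ideal_square I \<subseteq> ?T"
    unfolding ideal_square_def by (intro ideal_gen_least) auto
  with sq insert.prems(1) obtain b where b: "b \<in> I" "(1 - e) * g - g * b \<in> ideal_gen H"
    by auto
  define e' where "e' = e + (e + b) * (1 - e)"
  have e': "1 - e' = (1 - e - b) * (1 - e)"
    by (simp add: e'_def algebra_simps)
  have "e' \<in> I"
    unfolding e'_def using b(1) insert.prems(2) by (intro is_ideal_add is_ideal_mult_right I)
  moreover have "(1 - e') * x \<in> ideal_gen H" if x: "x \<in> I" for x
  proof -
    obtain c where c: "(1 - e) * x - g * c \<in> ideal_gen H"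
      using ideal_gen_insertE[OF insert.prems(3)[OF x]] by blast
    have "(1 - e') * x = (1 - e - b) * ((1 - e) * x - g * c) + c * ((1 - e) * g - g * b)"
      unfolding e' by (simp add: algebra_simps)
    with b c show ?thesis
      using is_ideal_mult[OF H] is_ideal_add[OF H] by simp
  qed
  ultimately show ?case
    using insert.IH[of e'] insert.prems(1) by auto
qed

lemma idempotent_ideal_eq_UNIV:
  assumes G: "finite G" "I = ideal_gen G" and sq: "I \<subseteq> ideal_square I"
    and a: "a \<in> I" "\<And>y. a * y = 0 \<Longrightarrow> y = 0"
  shows "I = UNIV"
proof -
  have I: "is_ideal I" using G is_ideal_gen by simp
  have "\<exists>e\<in>I. \<forall>x\<in>I. (1 - e) * x = 0"
  proof (rule idempotent_ideal_aux[OF I sq G(1), of 0])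
    show "G \<subseteq> I" using G ideal_gen_superset by simp
  qed (use G is_ideal_zero[OF I] in auto)
  then obtain e where "e \<in> I" "(1 - e) * a = 0" using a(1) by blast
  then have "1 - e = 0"
    using a(2) by (metis mult.commute)
  with \<open>e \<in> I\<close> show ?thesis
    using is_ideal_UNIV_iff[OF I] by simp
qed

subsection \<open>Determinants modulo an ideal\<close>

lemma prod_cong_mod_ideal:
  assumes "is_ideal J" "\<And>i. i \<in> A \<Longrightarrow> f i - g i \<in> J"
  shows "prod f A - prod g A \<in> J"
  using assms(2)
proof (induction A rule: infinite_finite_induct)
  case (insert x A)
  have "prod f (insert x A) - prod g (insert x A) = f x * (prod f A - prod g A) + (f x - g x) * prod g A"
    using insert by (simp add: algebra_simps)
  moreover have "f x * (prod f A - prod g A) + (f x - g x) * prod g A \<in> J"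
    using insert by (intro is_ideal_add is_ideal_mult is_ideal_mult_right assms(1)) auto
  ultimately show ?case by simp
qed (use assms in \<open>auto simp: is_ideal_zero\<close>)

lemma det_cong_mod_ideal:
  assumes J: "is_ideal J" and "A \<in> carrier_mat N N" "B \<in> carrier_mat N N"
    and "\<And>i j. i < N \<Longrightarrow> j < N \<Longrightarrow> A $$ (i, j) - B $$ (i, j) \<in> J"
  shows "det A - det B \<in> J"
  unfolding det_def'[OF assms(2)] det_def'[OF assms(3)] sum_subtractf[symmetric]
    right_diff_distrib[symmetric]
proof (intro is_ideal_sum is_ideal_mult prod_cong_mod_ideal J)
  fix p i assume "p \<in> {p. p permutes {0..<N}}" "i \<in> {0..<N}"
  then have "p i < N"
    using permutes_in_image[of p "{0..<N}" i] by auto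
  with \<open>i \<in> _\<close> show "A $$ (i, p i) - B $$ (i, p i) \<in> J"
    by (intro assms(4)) auto
qed

text \<open>Padded with zeros to size \<open>N\<close>, the first factor is singular. So the product
  has determinant 0, while it is congruent to a scalar matrix with determinant
  \<open>e ^ N\<close>.\<close>

lemma scalar_mod_ideal_factorization:
  fixes P Q :: "nat \<Rightarrow> nat \<Rightarrow> 'a::comm_ring_1"
  assumes J: "is_ideal J"
    and PQ: "\<And>i j. i < N \<Longrightarrow> j < N \<Longrightarrow> (\<Sum>t<M. P i t * Q t j) - (if i = j then e else 0) \<in> J"
    and M: "M < N \<or> M = N \<and> det (mat N N (\<lambda>(i, j). P i j)) = 0"
  shows "e ^ N \<in> J"
proof -
  define A where "A = mat N N (\<lambda>(i, t). if t < M then P i t else 0)"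
  define B where "B = mat N N (\<lambda>(t, j). if t < M then Q t j else 0)"
  have AB: "A \<in> carrier_mat N N" "B \<in> carrier_mat N N"
    by (auto simp: A_def B_def)
  have "det A = 0"
  proof (cases "M < N")
    case True
    have "det A = (\<Sum>i<N. A $$ (i, M) * cofactor A i M)"
      by (rule laplace_expansion_column[OF AB(1) True])
    also have "\<dots> = 0"
      using True by (intro sum.neutral) (auto simp: A_def)
    finally show ?thesis .
  next
    case False
    with M have "M = N" "A = mat N N (\<lambda>(i, j). P i j)" by (auto simp: A_def)
    with M show ?thesis by simp
  qed
  then have "det (A * B) = 0"
    using det_mult[OF AB] by simp
  moreover have "det (A * B) - det (e \<cdot>\<^sub>m 1\<^sub>m N) \<in> J"
  proof (rule det_cong_mod_ideal[OF J])
    fix i j assume ij: "i < N" "j < N"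
    have "(A * B) $$ (i, j) = (\<Sum>t<N. A $$ (i, t) * B $$ (t, j))"
      using ij AB by (simp add: scalar_prod_def atLeast0LessThan)
    also have "\<dots> = (\<Sum>t<M. P i t * Q t j)"
    proof (rule sum.mono_neutral_cong_right)
      show "{..<M} \<subseteq> {..<N}" using M by auto
    qed (use ij M in \<open>auto simp: A_def B_def\<close>)
    finally show "(A * B) $$ (i, j) - (e \<cdot>\<^sub>m 1\<^sub>m N) $$ (i, j) \<in> J"
      using PQ[OF ij] ij by (cases "i = j") auto
  qed (use AB in auto)
  ultimately have "- (e ^ N) \<in> J" by simp
  then show ?thesis using is_ideal_uminus[OF J] by fastforce
qed

text \<open>The terms of a permutation and its inverse cancel, as an odd number of entries changes
  sign. A self-inverse permutation of an odd set has a fixed point and meets the zero diagonal. No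
  division by 2 occurs.\<close>

lemma det_odd_alternating:
  fixes A :: "'a::comm_ring_1 mat"
  assumes A: "A \<in> carrier_mat N N" and "odd N"
    and skew: "\<And>i j. i < N \<Longrightarrow> j < N \<Longrightarrow> A $$ (i, j) = - A $$ (j, i)"
    and diag: "\<And>i. i < N \<Longrightarrow> A $$ (i, i) = 0"
  shows "det A = 0"
proof -
  define X where "X = {p. p permutes {0..<N}}"
  define F where "F p = (signof p :: 'a) * (\<Prod>i = 0..<N. A $$ (i, p i))" for p
  let ?inv = "Hilbert_Choice.inv"
  have in_N: "p i < N" if "p \<in> X" "i < N" for p i
    using that permutes_in_image[of p "{0..<N}" i] by (auto simp: X_def)
  have finX: "finite X"
    unfolding X_def by (rule finite_permutations) simp
  have inv_X: "?inv p \<in> X" "?inv (?inv p) = p" if "p \<in> X" for p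
    using that permutes_inv permutes_inv_inv by (auto simp: X_def)
  have "F p = 0" if p: "p \<in> X" "?inv p = p" for p
  proof -
    have pp: "p (p i) = i" for i
      using p permutes_inverses(1)[of p "{0..<N}"] by (auto simp: X_def)
    have "\<exists>i<N. p i = i"
    proof (rule ccontr)
      assume nofix: "\<not> (\<exists>i<N. p i = i)"
      \<comment> \<open>Without fixed points the 2-cycles split the indices into smaller and larger
        partners, so \<open>N\<close> would be even.\<close>
      define Y where "Y = {i. i < N \<and> i < p i}"
      have "{..<N} = Y \<union> p ` Y"
      proof (intro equalityI subsetI)
        fix i assume i: "i \<in> {..<N}"
        then consider "i < p i" | "p i < i"
          using nofix by (meson lessThan_iff linorder_neqE_nat)
        then show "i \<in> Y \<union> p ` Y"
        proof cases
          case 2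
          then have "p i \<in> Y" using i by (auto simp: Y_def pp)
          then show ?thesis using pp[of i] by (metis UnI2 imageI)
        qed (use i in \<open>auto simp: Y_def\<close>)
      qed (auto simp: Y_def in_N[OF p(1)])
      moreover have "Y \<inter> p ` Y = {}"
        by (auto simp: Y_def pp)
      moreover have "finite Y" "inj_on p Y"
        using pp by (auto simp: Y_def inj_on_def) metis
      ultimately have "N = card Y + card Y"
        by (metis card_Un_disjoint card_image card_lessThan finite_imageI)
      with \<open>odd N\<close> show False by presburger
    qed
    then obtain i where "i < N" "p i = i" by blast
    then have "(\<Prod>i = 0..<N. A $$ (i, p i)) = 0"
      using diag[of i] by (intro prod_zero bexI[of _ i]) auto
    then show ?thesis by (simp add: F_def)
  qed
  moreover have "F (?inv p) + F p = 0" if p: "p \<in> X" for p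
  proof -
    have perm: "p permutes {0..<N}" using p by (simp add: X_def)
    have "(\<Prod>i = 0..<N. A $$ (i, ?inv p i)) = (\<Prod>i = 0..<N. A $$ (p i, ?inv p (p i)))"
      using prod.permute[OF perm, of "\<lambda>i. A $$ (i, ?inv p i)"] by (simp add: comp_def)
    also have "\<dots> = (\<Prod>i = 0..<N. - A $$ (i, p i))"
      unfolding permutes_inverses(2)[OF perm]
      by (intro prod.cong refl skew) (auto simp: in_N[OF p])
    also have "\<dots> = (\<Prod>i = 0..<N. (-1) * A $$ (i, p i))"
      by simp
    also have "\<dots> = (- 1) ^ N * (\<Prod>i = 0..<N. A $$ (i, p i))"
      unfolding prod.distrib by simp
    finally have "(\<Prod>i = 0..<N. A $$ (i, ?inv p i)) = - (\<Prod>i = 0..<N. A $$ (i, p i))"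
      using \<open>odd N\<close> by simp
    moreover have "(signof (?inv p) :: 'a) = signof p"
      by (rule signof_inv[OF _ perm]) simp
    ultimately show ?thesis
      by (simp add: F_def)
  qed
  ultimately have "(\<Sum>p\<in>{p \<in> X. ?inv p \<noteq> p}. F p) = 0"
    by (intro sum_involution_eq_0[where h = ?inv]) (auto simp: inv_X)
  moreover have "(\<Sum>p\<in>X. F p) = (\<Sum>p\<in>{p \<in> X. ?inv p \<noteq> p}. F p)"
    using finX \<open>\<And>p. \<lbrakk>p \<in> X; ?inv p = p\<rbrakk> \<Longrightarrow> F p = 0\<close>
    by (intro sum.mono_neutral_right) auto
  ultimately show ?thesis
    unfolding det_def'[OF A] F_def X_def by simp
qed

text \<open>Pascal's rule, starting from 4 choose 2. Applied to the number of essential minors, it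
  leaves only subsets with one element or with one missing element.\<close>

lemma binomial_gt:
  assumes "2 \<le> s" "s + 2 \<le> M"
  shows "M < M choose s"
  using assms
proof (induction M arbitrary: s)
  case (Suc M)
  obtain s' where s: "s = Suc s'" using Suc.prems by (cases s) auto
  have rec: "Suc M choose s = (M choose s') + (M choose s)"
    by (simp add: s)
  show ?case
  proof (cases "s + 2 \<le> M")
    case True
    with Suc.IH[of s] Suc.prems have "M < M choose s" by simp
    moreover have "0 < M choose s'" using Suc.prems s by simp
    ultimately show ?thesis using rec by linarith
  next
    case False
    then have M: "M = Suc s" using Suc.prems by simp
    show ?thesis
    proof (cases "s = 2")
      case True
      with M have "M = 3" by simp
      with True show ?thesis by (simp add: numeral_eq_Suc)
    next
      case neq: False
      have "M < M choose s'"
        using Suc.IH[of s'] Suc.prems neq M s by simp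
      moreover have "M choose s = M" using M by simp
      ultimately show ?thesis using rec Suc.prems by linarith
    qed
  qed
qed simp

subsection \<open>A row annihilating all columns\<close>

lemma ideal_gen_imageE:
  fixes n :: nat
  assumes "x \<in> ideal_gen (g ` {..<n})"
  obtains c where "x = (\<Sum>j<n. c j * g j)"
proof -
  let ?I = "{x. \<exists>c. x = (\<Sum>j<n. c j * g j)}"
  have "is_ideal ?I"
    unfolding is_ideal_def
  proof (intro conjI ballI allI)
    show "0 \<in> ?I" by (auto intro: exI[of _ "\<lambda>_. 0"])
  next
    fix x y assume "x \<in> ?I" "y \<in> ?I"
    then obtain c d where "x = (\<Sum>j<n. c j * g j)" "y = (\<Sum>j<n. d j * g j)" by auto
    then have "x + y = (\<Sum>j<n. (c j + d j) * g j)"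
      by (simp add: distrib_right sum.distrib)
    then show "x + y \<in> ?I" by (intro CollectI exI[of _ "\<lambda>j. c j + d j"])
  next
    fix r x assume "x \<in> ?I"
    then obtain c where "x = (\<Sum>j<n. c j * g j)" by auto
    then have "r * x = (\<Sum>j<n. (r * c j) * g j)"
      by (simp add: sum_distrib_left mult.assoc)
    then show "r * x \<in> ?I" by (intro CollectI exI[of _ "\<lambda>j. r * c j"])
  qed
  moreover have "g i \<in> ?I" if "i < n" for i
  proof -
    have "(\<Sum>j<n. (if j = i then 1 else 0) * g j) = (\<Sum>j<n. if j = i then g j else 0)"
      by (intro sum.cong) auto
    also have "\<dots> = g i" using that by (subst sum.delta) auto
    finally show ?thesis by (intro CollectI exI[of _ "\<lambda>j. if j = i then 1 else 0"]) simp
  qed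
  ultimately have "ideal_gen (g ` {..<n}) \<subseteq> ?I"
    by (intro ideal_gen_least) auto
  with assms that show thesis by blast
qed

lemma Es_units_support:
  assumes "Es n (\<lambda>i. unit_vec_fun (h i)) l u S \<noteq> 0" "\<And>i. i < l \<Longrightarrow> h i < n"
  shows "u (S - h ` {..<l}) \<noteq> 0"
  using assms
proof (induction l arbitrary: h S)
  case (Suc l)
  let ?h = "\<lambda>i. h (Suc i)"
  have "eps (h 0) (Es n (\<lambda>i. unit_vec_fun (?h i)) l u) S \<noteq> 0"
    using Suc.prems(1) Suc.prems(2)[of 0] by (simp add: wdg_unit)
  then have "Es n (\<lambda>i. unit_vec_fun (?h i)) l u (S - {h 0}) \<noteq> 0"
    by (auto simp: eps_def split: if_splits)
  then have "u ((S - {h 0}) - ?h ` {..<l}) \<noteq> 0"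
    using Suc.prems(2) by (intro Suc.IH) auto
  moreover have "(S - {h 0}) - ?h ` {..<l} = S - h ` {..<Suc l}"
    unfolding lessThan_Suc_eq_insert_0 by (auto simp: image_image)
  ultimately show ?case by simp
qed simp

lemma wdg_bas_empty: "wdg n g (bas {}) = (\<Sum>t<n. scl (g t) (bas {t}))"
  unfolding wdg_def by (intro sum.cong refl arg_cong[where f = "scl _"] eps_bas) auto

text \<open>A form of Cramer's rule: modulo the rows \<open>h i\<close>, the entries with index in \<open>K\<close> are combinations
  of the others, up to the minor with columns \<open>K\<close>.\<close>

lemma kernel_entries_combination:
  fixes g :: "nat \<Rightarrow> 'a::comm_ring_1"
  assumes K: "K \<subseteq> {..<n}" "card K = k" and ker: "\<And>i. i < k \<Longrightarrow> pairing n (h i) g = 0"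
  shows "\<exists>R. \<forall>j<n. minor n h k K * g j = (\<Sum>t\<in>{..<n} - K. R j t * g t)"
proof -
  let ?E = "Es n (\<lambda>i. unit_vec_fun (pick K i)) k"
  let ?z = "wdg n g (bas {})"
  define R where "R j t = Fs n h k (?E (bas {t})) {j}" for j t
  have linE: "lin ?E" by (rule gop_lin[OF gop_Es])
  have "ctr n (h i) ?z = 0" if "i < k" for i
    using ker[OF that] unfolding ctr_wdg pairing_def
    by (simp add: ctr_bas_empty lin_zero[OF lin_wdg])
  then have *: "Fs n h k (?E ?z) = scl (minor n h k K) ?z"
    unfolding gcomms_minor[OF K, symmetric] by (intro gcomms_eq_Fs[symmetric] gop_Es)
  have "minor n h k K * g j = (\<Sum>t\<in>{..<n} - K. R j t * g t)" if "j < n" for j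
  proof -
    have "minor n h k K * g j = Fs n h k (?E ?z) {j}"
      unfolding * by (simp add: scl_apply wdg_bas_empty_singleton[OF that])
    also have "\<dots> = (\<Sum>t<n. R j t * g t)"
      unfolding wdg_bas_empty lin_sum[OF linE] lin_scl[OF linE] lin_sum[OF lin_Fs] lin_scl[OF lin_Fs]
      by (simp add: sum_fun_apply scl_apply R_def mult.commute)
    also have "\<dots> = (\<Sum>t\<in>{..<n} - K. R j t * g t)"
    proof (rule sum.mono_neutral_right)
      \<comment> \<open>For \<open>t \<in> K\<close> the wedge of e_K with e_t is zero.\<close>
      show "\<forall>t\<in>{..<n} - ({..<n} - K). R j t * g t = 0"
      proof
        fix t assume "t \<in> {..<n} - ({..<n} - K)"
        then have "t \<in> K" by auto
        have "?E (bas {t} :: 'a ext) S = 0" for S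
        proof (rule ccontr)
          assume "?E (bas {t} :: 'a ext) S \<noteq> 0"
          then have "(bas {t} :: 'a ext) (S - pick K ` {..<k}) \<noteq> 0"
            by (rule Es_units_support) (use pick_less[OF K(1)] K(2) in auto)
          moreover have "pick K ` {..<k} = K"
            using pick_image[OF K(1)] K(2) by simp
          ultimately have "S - K = {t}"
            by (simp add: bas_def split: if_splits)
          with \<open>t \<in> K\<close> show False by auto
        qed
        then have "?E (bas {t} :: 'a ext) = 0" by (simp add: fun_eq_iff pointwise)
        then show "R j t * g t = 0"
          unfolding R_def by (simp add: lin_zero[OF lin_Fs] pointwise)
      qed
    qed auto
    finally show ?thesis .
  qed
  then show ?thesis by blast
qed

text \<open>Contracting by the basis forms of \<open>L\<close> strips \<open>L\<close> off
  \<open>K \<union> L\<close>. The sign is left unspecified because only its square is used.\<close>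

lemma Fs_bas_union:
  assumes "finite L" "L \<inter> K = {}"
  shows "\<exists>\<sigma>. \<sigma> * \<sigma> = 1 \<and> Fs n f k (bas (K \<union> L)) L = \<sigma> * minor n f k K"
  using assms
proof (induction L)
  case empty
  then show ?case by (intro exI[of _ 1]) (simp add: minor_def)
next
  case (insert j L)
  then obtain \<sigma> where \<sigma>: "\<sigma> * \<sigma> = 1" "Fs n f k (bas (K \<union> L)) L = \<sigma> * minor n f k K" by auto
  have *: "K \<union> insert j L - {j} = K \<union> L" using insert by auto
  define s t where "s = (sg j L :: 'a)" and "t = (sg j (K \<union> insert j L) :: 'a)"
  have "Fs n f k (bas (K \<union> insert j L)) (insert j L)
      = s * ((- 1) ^ k * (t * (\<sigma> * minor n f k K)))"
    unfolding apply_insert_eq[OF insert.hyps(2)] iota_Fs iota_bas * s_def t_def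
    using \<sigma>(2) by (simp add: lin_scl[OF lin_Fs] scl_apply)
  then have "Fs n f k (bas (K \<union> insert j L)) (insert j L) = (s * (- 1) ^ k * t * \<sigma>) * minor n f k K"
    by (simp add: mult.assoc)
  moreover have "(s * (- 1) ^ k * t * \<sigma>) * (s * (- 1) ^ k * t * \<sigma>)
      = (s * s) * ((- 1) ^ k * (- 1) ^ k) * (t * t) * (\<sigma> * \<sigma>)"
    by (simp only: ac_simps)
  then have "(s * (- 1) ^ k * t * \<sigma>) * (s * (- 1) ^ k * t * \<sigma>) = 1"
    using \<sigma>(1) by (simp add: s_def t_def neg_one_power_sq)
  ultimately show ?case by blast
qed

lemma Fs_eq_0_at:
  assumes "\<And>K. K \<subseteq> {..<n} \<Longrightarrow> K \<inter> S = {} \<Longrightarrow> card K = l \<Longrightarrow> u (S \<union> K) = 0"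
  shows "Fs n f l u S = 0"
  using Fs_cong_at[of n S l u 0 f] assms by (simp add: lin_zero[OF lin_Fs] pointwise)

lemma Fs_cong: "(\<And>i. i < l \<Longrightarrow> f i = g i) \<Longrightarrow> Fs n f l u = Fs n g l u"
  by (induction l arbitrary: u) auto

text \<open>The right-hand side changes sign when \<open>s\<close> and \<open>t\<close> are
  exchanged and vanishes for \<open>s = t\<close>, which makes the transition matrix
  alternating.\<close>

lemma iota_skew_apply:
  "Fs n h k (iota t a) {s} = (- 1) ^ k * Fs n h k (iota s (iota t a)) {}"
proof -
  have "Fs n h k (iota t a) {s} = iota s (Fs n h k (iota t a)) {}"
    by (simp add: iota_def)
  then show ?thesis
    by (simp add: iota_Fs scl_apply)
qed

text \<open>Let \<open>\<epsilon>\<close> be a \<open>k\<close>-minor of \<open>f\<close>, formed with the rows \<open>idx\<close> and the columns \<open>K\<close>, and let \<open>J\<close>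
  contain all minors of size \<open>k + 1\<close>. If the row \<open>g\<close> annihilates \<open>f\<close> and all maximal minors of \<open>f\<close>
  are combinations of the entries of \<open>g\<close>, then up to powers of \<open>\<epsilon>\<close> the \<open>(n - k choose m - k)\<close>
  essential minors are combinations of \<open>n - k\<close> entries, and conversely. As the relations between
  the minors have coefficients in the image of the complex, this gives a factorization of a
  multiple of the identity modulo \<open>J\<close> through a free module of rank \<open>n - k\<close>.\<close>

lemma minors_factor_through_row:
  fixes f :: "nat \<Rightarrow> nat \<Rightarrow> 'a::comm_ring_1"
  assumes reg: "regular_seq (mideal n f m) xs" "Suc (n - m) \<le> length xs" and "m \<le> n"
    and ker: "\<And>i. i < m \<Longrightarrow> pairing n (f i) g = 0"
    and sub: "mideal n f m \<subseteq> ideal_gen (g ` {..<n})"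
    and J: "is_ideal J" and "k < m" and idx: "\<And>i. i < k \<Longrightarrow> idx i < m"
    and K: "K \<subseteq> {..<n}" "card K = k"
    and bigger: "\<And>idx' K'. (\<And>i. i < Suc k \<Longrightarrow> idx' i < m) \<Longrightarrow> K' \<subseteq> {..<n} \<Longrightarrow> card K' = Suc k
      \<Longrightarrow> minor n (\<lambda>i. f (idx' i)) (Suc k) K' \<in> J"
  defines "h \<equiv> \<lambda>i. f (idx i)"
  defines "\<epsilon> \<equiv> minor n h k K"
  shows "\<exists>a Q. \<forall>L L'. L \<subseteq> {..<n} - K \<longrightarrow> L' \<subseteq> {..<n} - K \<longrightarrow> card L = m - k \<longrightarrow> card L' = m - k \<longrightarrow>
    (\<Sum>t\<in>{..<n} - K. Fs n h k (iota t a) L * Q t L') - (if L = L' then \<epsilon> * \<epsilon> else 0) \<in> J"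
proof -
  define T where "T = {..<n} - K"
  obtain a0 where a0: "wdg n g (bas {}) = Fs n f m a0"
    using left_kernel_eq_Fs[OF reg ker] by blast
  \<comment> \<open>Exactness bounds the degree of \<open>a0\<close> only from below; at singletons
    \<open>Fs\<close> reads just the coordinates of degree \<open>Suc m\<close>.\<close>
  define a where "a S = (if S \<subseteq> {..<n} \<and> card S = Suc m then a0 S else 0)" for S
  have g_a: "g j = (- 1) ^ m * Fs n f m (iota j a) {}" if j: "j < n" for j
  proof -
    have "g j = Fs n f m a0 {j}"
      using wdg_bas_empty_singleton[OF j, of g] a0 by simp
    also have "\<dots> = Fs n f m a {j}"
    proof (rule Fs_cong_at)
      fix K' assume K': "K' \<subseteq> {..<n}" "K' \<inter> {j} = {}" "card K' = m"
      then have "finite K'" using finite_subset by blast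
      then have "card ({j} \<union> K') = Suc m" using K' by auto
      with K' j show "a0 ({j} \<union> K') = a ({j} \<union> K')" by (auto simp: a_def)
    qed
    also have "\<dots> = iota j (Fs n f m a) {}"
      by (simp add: iota_def)
    finally show ?thesis by (simp add: iota_Fs scl_apply)
  qed
  have "\<exists>w. minor n f m S = (\<Sum>j<n. w j * g j)" if "S \<subseteq> {..<n}" "card S = m" for S
  proof -
    have "minor n f m S \<in> ideal_gen (g ` {..<n})"
      using minor_in_mideal[OF that] sub by blast
    then show ?thesis by (elim ideal_gen_imageE) blast
  qed
  then obtain W where W: "\<And>S. S \<subseteq> {..<n} \<Longrightarrow> card S = m \<Longrightarrow> minor n f m S = (\<Sum>j<n. W S j * g j)"
    by metis
  \<comment> \<open>Cramer's rule: up to \<epsilon>, the entries of \<open>g\<close> with index in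
    \<open>K\<close> are replaced by those with index in \<open>T\<close>.\<close>
  obtain R where R: "\<And>j. j < n \<Longrightarrow> \<epsilon> * g j = (\<Sum>t\<in>T. R j t * g t)"
    using kernel_entries_combination[OF K, of h g] ker idx unfolding \<epsilon>_def T_def h_def by blast
  define W' where "W' S t = (\<Sum>j<n. W S j * R j t)" for S t
  have W': "\<epsilon> * minor n f m S = (\<Sum>t\<in>T. W' S t * g t)" if S: "S \<subseteq> {..<n}" "card S = m" for S
  proof -
    have "\<epsilon> * minor n f m S = (\<Sum>j<n. W S j * (\<epsilon> * g j))"
      unfolding W[OF S] by (simp add: sum_distrib_left mult.left_commute)
    also have "\<dots> = (\<Sum>j<n. \<Sum>t\<in>T. W S j * (R j t * g t))"
      by (intro sum.cong refl) (simp add: R sum_distrib_left)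
    also have "\<dots> = (\<Sum>t\<in>T. \<Sum>j<n. W S j * (R j t * g t))"
      by (rule sum.swap)
    also have "\<dots> = (\<Sum>t\<in>T. W' S t * g t)"
      unfolding W'_def by (simp add: sum_distrib_right mult.assoc)
    finally show ?thesis .
  qed
  have key: "\<epsilon> * Fs n h k (bas S) L - (- 1) ^ m * (\<Sum>t\<in>T. W' S t * Fs n h k (iota t a) L) \<in> J"
    if S: "S \<subseteq> {..<n}" "card S = m" and "finite L" for S L
  proof -
    \<comment> \<open>This is the relation between maximal minors obtained by writing \<epsilon>
      times the minor at \<open>S\<close> through the entries in \<open>T\<close>, each of these
      being a full contraction of \<open>iota t a\<close> up to sign.\<close>
    define c where "c = scl \<epsilon> (bas S) - scl ((- 1) ^ m) (\<Sum>t\<in>T. scl (W' S t) (iota t a))"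
    have iota_a: "iota t a X = 0" if "t < n" "\<not> (X \<subseteq> {..<n} \<and> card X = m)" for t X
    proof (rule ccontr)
      assume "iota t a X \<noteq> 0"
      then have tX: "t \<notin> X" "insert t X \<subseteq> {..<n}" "card (insert t X) = Suc m"
        by (auto simp: iota_def a_def split: if_splits)
      then have "finite X" by (meson finite_lessThan finite_insert finite_subset)
      with tX that show False by simp
    qed
    have c0: "c X = 0" if "\<not> (X \<subseteq> {..<n} \<and> card X = m)" for X
    proof -
      have "(\<Sum>t\<in>T. W' S t * iota t a X) = 0"
        using that by (intro sum.neutral) (auto simp: iota_a T_def)
      moreover have "X \<noteq> S" using that S by auto
      ultimately show ?thesis
        by (simp add: c_def pointwise scl_apply sum_fun_apply bas_def)
    qed
    have "Fs n f m c X = 0" for X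
    proof (cases "X = {}")
      case True
      have "Fs n f m c {} = \<epsilon> * minor n f m S
          - (- 1) ^ m * (\<Sum>t\<in>T. W' S t * Fs n f m (iota t a) {})"
        unfolding c_def lin_diff[OF lin_Fs] lin_scl[OF lin_Fs] lin_sum[OF lin_Fs]
        by (simp add: pointwise scl_apply sum_fun_apply minor_def)
      also have "(- 1) ^ m * (\<Sum>t\<in>T. W' S t * Fs n f m (iota t a) {}) = (\<Sum>t\<in>T. W' S t * g t)"
        unfolding sum_distrib_left by (intro sum.cong refl) (auto simp: g_a T_def mult.left_commute)
      finally show ?thesis using True W'[OF S] by simp
    next
      case False
      show ?thesis
      proof (rule Fs_eq_0_at)
        fix K' assume K': "K' \<subseteq> {..<n}" "K' \<inter> X = {}" "card K' = m"
        show "c (X \<union> K') = 0"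
        proof (rule c0, rule notI)
          assume *: "X \<union> K' \<subseteq> {..<n} \<and> card (X \<union> K') = m"
          then have "finite (X \<union> K')" using finite_subset by blast
          then have "K' = X \<union> K'" using * K' by (intro card_subset_eq) auto
          with False K' show False by auto
        qed
      qed
    qed
    then have "Fs n f m c = 0" by (simp add: fun_eq_iff pointwise)
    moreover have "low n m c"
      unfolding low_def
    proof (intro allI impI)
      fix S assume "c S \<noteq> 0"
      with c0[of S] show "S \<subseteq> {..<n} \<and> m \<le> card S" by auto
    qed
    \<comment> \<open>Relations between maximal minors are sums of contractions by the
      \<open>f i\<close>. The \<open>k\<close> further contractions by \<open>h\<close> produce
      coordinates in the ideal of minors of size \<open>k + 1\<close>, hence in
      \<open>J\<close>.\<close>
    ultimately obtain w where w: "c = (\<Sum>i<m. ctr n (f i) (w i))"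
      using kernel_Fs[OF reg(1)] reg(2) \<open>m \<le> n\<close> by (auto simp: Suc_diff_le)
    have "Fs n h k (ctr n (f i) (w i)) L \<in> J" if "i < m" for i
    proof -
      let ?idx = "idx(k := i)"
      have "Fs n h k u = Fs n (\<lambda>i. f (?idx i)) k u" for u
        unfolding h_def by (rule Fs_cong) simp
      then have "Fs n h k (ctr n (f i) (w i)) L = Fs n (\<lambda>i. f (?idx i)) (Suc k) (w i) L"
        by simp
      also have "\<dots> \<in> mideal n (\<lambda>i. f (?idx i)) (Suc k)"
        by (rule Fs_in_mideal[OF \<open>finite L\<close>])
      also have "mideal n (\<lambda>i. f (?idx i)) (Suc k) \<subseteq> J"
        unfolding mideal_def using idx that by (intro ideal_gen_least J) (auto intro!: bigger)
      finally show ?thesis .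
    qed
    then have "Fs n h k c L \<in> J"
      unfolding w lin_sum[OF lin_Fs] sum_fun_apply by (intro is_ideal_sum J) auto
    then show ?thesis
      unfolding c_def lin_diff[OF lin_Fs] lin_scl[OF lin_Fs] lin_sum[OF lin_Fs]
      by (simp add: pointwise scl_apply sum_fun_apply)
  qed
  have fin: "finite L" if "L \<subseteq> T" for L
    using that finite_subset[of L "{..<n}"] by (auto simp: T_def)
  have "\<exists>\<sigma>. \<sigma> * \<sigma> = 1 \<and> Fs n h k (bas (K \<union> L)) L = \<sigma> * \<epsilon>" if "L \<subseteq> T" for L
    unfolding \<epsilon>_def using fin[OF that] that by (intro Fs_bas_union) (auto simp: T_def)
  then obtain \<sigma> where \<sigma>: "\<And>L. L \<subseteq> T \<Longrightarrow> \<sigma> L * \<sigma> L = 1"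
    "\<And>L. L \<subseteq> T \<Longrightarrow> Fs n h k (bas (K \<union> L)) L = \<sigma> L * \<epsilon>" by metis
  have off: "Fs n h k (bas (K \<union> L')) L = 0"
    if "L \<subseteq> T" "L' \<subseteq> T" "card L = card L'" "L \<noteq> L'" for L L'
  proof (rule Fs_eq_0_at)
    fix K' assume "K' \<subseteq> {..<n}" "K' \<inter> L = {}" "card K' = k"
    have "L \<union> K' \<noteq> K \<union> L'"
    proof
      assume "L \<union> K' = K \<union> L'"
      then have "L \<subseteq> L'" using that(1) by (auto simp: T_def)
      with card_subset_eq[OF fin[OF that(2)] this that(3)] that(4) show False by simp
    qed
    then show "bas (K \<union> L') (L \<union> K') = (0 :: 'a)" by (simp add: bas_def)
  qed
  define Q where "Q t L = (- 1) ^ m * W' (K \<union> L) t * \<sigma> L" for t L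
  have "(\<Sum>t\<in>T. Fs n h k (iota t a) L * Q t L') - (if L = L' then \<epsilon> * \<epsilon> else 0) \<in> J"
    if L: "L \<subseteq> T" "L' \<subseteq> T" "card L = m - k" "card L' = m - k" for L L'
  proof -
    have "finite K" using K(1) finite_subset by blast
    then have "card (K \<union> L') = m"
      using L fin[of L'] K \<open>k < m\<close> by (subst card_Un_disjoint) (auto simp: T_def)
    moreover have "K \<union> L' \<subseteq> {..<n}" using K L by (auto simp: T_def)
    ultimately have "\<epsilon> * Fs n h k (bas (K \<union> L')) L
        - (- 1) ^ m * (\<Sum>t\<in>T. W' (K \<union> L') t * Fs n h k (iota t a) L) \<in> J" (is "?x \<in> J")
      using fin[OF L(1)] by (intro key) auto
    then have "- \<sigma> L' * ?x \<in> J" by (rule is_ideal_mult[OF J])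
    moreover have "\<epsilon> * Fs n h k (bas (K \<union> L')) L * \<sigma> L' = (if L = L' then \<epsilon> * \<epsilon> else 0)"
    proof (cases "L = L'")
      case True
      have "\<epsilon> * Fs n h k (bas (K \<union> L')) L * \<sigma> L' = \<epsilon> * \<epsilon> * (\<sigma> L' * \<sigma> L')"
        using True \<sigma>(2)[OF L(2)] by (simp add: ac_simps)
      then show ?thesis using True \<sigma>(1)[OF L(2)] by simp
    next
      case False
      with off[OF L(1,2)] L show ?thesis by simp
    qed
    moreover have "(\<Sum>t\<in>T. Fs n h k (iota t a) L * Q t L')
        = (- 1) ^ m * (\<Sum>t\<in>T. W' (K \<union> L') t * Fs n h k (iota t a) L) * \<sigma> L'"
      unfolding Q_def sum_distrib_left sum_distrib_right by (intro sum.cong refl) (simp add: ac_simps)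
    ultimately show ?thesis
      by (simp add: algebra_simps)
  qed
  then show ?thesis
    unfolding T_def by blast
qed

text \<open>The square of the minor, as a scalar on \<open>n - k choose m - k\<close> generators,
  factors modulo \<open>J\<close> through rank \<open>n - k\<close>. Counting gives the alternative.
  If \<open>m - k = 1\<close>, both ranks agree and the first factor is alternating, so
  \<open>n - k\<close> is even.\<close>

lemma row_codimension:
  fixes f :: "nat \<Rightarrow> nat \<Rightarrow> 'a::comm_ring_1"
  assumes reg: "regular_seq (mideal n f m) xs" "Suc (n - m) \<le> length xs" and "m < n"
    and ker: "\<And>i. i < m \<Longrightarrow> pairing n (f i) g = 0"
    and sub: "mideal n f m \<subseteq> ideal_gen (g ` {..<n})"
    and J: "is_ideal J" and "k < m" and idx: "\<And>i. i < k \<Longrightarrow> idx i < m"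
    and K: "K \<subseteq> {..<n}" "card K = k"
    and bigger: "\<And>idx' K'. (\<And>i. i < Suc k \<Longrightarrow> idx' i < m) \<Longrightarrow> K' \<subseteq> {..<n} \<Longrightarrow> card K' = Suc k
      \<Longrightarrow> minor n (\<lambda>i. f (idx' i)) (Suc k) K' \<in> J"
    and eps: "\<And>N. minor n (\<lambda>i. f (idx i)) k K ^ N \<notin> J"
  shows "odd (n - m) \<and> (n - m = 1 \<or> m - k = 1)"
proof -
  define h where "h = (\<lambda>i. f (idx i))"
  define \<epsilon> where "\<epsilon> = minor n h k K"
  define T where "T = {..<n} - K"
  define M where "M = n - k"
  have "finite K" using K(1) finite_subset by blast
  then have T: "finite T" "card T = M"
    using K by (auto simp: T_def M_def card_Diff_subset)
  have eps': "(\<epsilon> * \<epsilon>) ^ N \<notin> J" for N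
    using eps[of "2 * N"] unfolding \<epsilon>_def h_def by (simp add: power_mult power2_eq_square)
  have "\<exists>a Q. \<forall>L L'. L \<subseteq> T \<longrightarrow> L' \<subseteq> T \<longrightarrow> card L = m - k \<longrightarrow> card L' = m - k \<longrightarrow>
    (\<Sum>t\<in>T. Fs n h k (iota t a) L * Q t L') - (if L = L' then \<epsilon> * \<epsilon> else 0) \<in> J"
    unfolding h_def \<epsilon>_def T_def
  proof (rule minors_factor_through_row[OF reg less_imp_le[OF \<open>m < n\<close>] _ sub J \<open>k < m\<close> _ K])
    show "pairing n (f i) g = 0" if "i < m" for i using ker that .
    show "idx i < m" if "i < k" for i using idx that .
    show "minor n (\<lambda>i. f (idx' i)) (Suc k) K' \<in> J"
      if "\<And>i. i < Suc k \<Longrightarrow> idx' i < m" "K' \<subseteq> {..<n}" "card K' = Suc k" for idx' K'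
      by (rule bigger) (use that in auto)
  qed
  then obtain a Q where PQ: "\<And>L L'. L \<subseteq> T \<Longrightarrow> L' \<subseteq> T \<Longrightarrow> card L = m - k \<Longrightarrow> card L' = m - k \<Longrightarrow>
    (\<Sum>t\<in>T. Fs n h k (iota t a) L * Q t L') - (if L = L' then \<epsilon> * \<epsilon> else 0) \<in> J"
    by blast
  obtain bT where bT: "bij_betw bT {..<M} T"
    using ex_bij_betw_nat_finite[OF T(1)] T(2) by (auto simp: atLeast0LessThan)
  have sumT: "(\<Sum>t\<in>T. F t) = (\<Sum>i<M. F (bT i))" for F :: "nat \<Rightarrow> 'a"
    using sum.reindex_bij_betw[OF bT] by metis
  define N where "N = (M choose (m - k))"
  define \<L> where "\<L> = {L. L \<subseteq> T \<and> card L = m - k}"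
  have "finite \<L>" "card \<L> = N"
    unfolding \<L>_def N_def using n_subsets[OF T(1)] T by auto
  then obtain bL where bL: "bij_betw bL {..<N} \<L>"
    using ex_bij_betw_nat_finite[of \<L>] by (auto simp: atLeast0LessThan)
  have "N \<le> M"
  proof (rule ccontr)
    assume "\<not> N \<le> M"
    have "(\<epsilon> * \<epsilon>) ^ N \<in> J"
    proof (rule scalar_mod_ideal_factorization[OF J, where M = M and
          P = "\<lambda>i t. Fs n h k (iota (bT t) a) (bL i)" and Q = "\<lambda>t j. Q (bT t) (bL j)"])
      fix i j assume ij: "i < N" "j < N"
      then have "bL i \<in> \<L>" "bL j \<in> \<L>" using bL bij_betwE by fastforce+
      moreover have "bL i = bL j \<longleftrightarrow> i = j"
        using bL ij by (auto simp: bij_betw_def inj_on_def)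
      ultimately show "(\<Sum>t<M. Fs n h k (iota (bT t) a) (bL i) * Q (bT t) (bL j))
          - (if i = j then \<epsilon> * \<epsilon> else 0) \<in> J"
        using PQ[of "bL i" "bL j"] unfolding sumT \<L>_def by simp
    qed (use \<open>\<not> N \<le> M\<close> in auto)
    with eps' show False by blast
  qed
  have M: "M = (m - k) + (n - m)"
    using \<open>k < m\<close> \<open>m < n\<close> by (simp add: M_def)
  have dims: "n - m = 1 \<or> m - k = 1"
  proof (rule ccontr)
    assume "\<not> (n - m = 1 \<or> m - k = 1)"
    then have "2 \<le> m - k" "(m - k) + 2 \<le> M"
      using \<open>k < m\<close> \<open>m < n\<close> M by auto
    from binomial_gt[OF this] \<open>N \<le> M\<close> show False by (simp add: N_def)
  qed
  moreover have "odd (n - m)" if mk: "m - k = 1"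
  proof (rule ccontr)
    assume "\<not> odd (n - m)"
    then have "odd M" using M mk by simp
    define P where "P i j = Fs n h k (iota (bT j) a) {bT i}" for i j
    have inT: "bT i \<in> T" if "i < M" for i
      using bT that bij_betwE by fastforce
    have "det (mat M M (\<lambda>(i, j). P i j)) = 0"
    proof (rule det_odd_alternating[OF _ \<open>odd M\<close>])
      fix i j assume "i < M" "j < M"
      have "P i j = - P j i"
        unfolding P_def iota_skew_apply
        by (subst iota_anticomm) (simp add: lin_uminus[OF lin_Fs] pointwise)
      then show "mat M M (\<lambda>(i, j). P i j) $$ (i, j) = - mat M M (\<lambda>(i, j). P i j) $$ (j, i)"
        using \<open>i < M\<close> \<open>j < M\<close> by simp
    next
      fix i assume "i < M"
      have "P i i = 0"
        unfolding P_def iota_skew_apply by (simp add: lin_zero[OF lin_Fs] pointwise)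
      then show "mat M M (\<lambda>(i, j). P i j) $$ (i, i) = 0"
        using \<open>i < M\<close> by simp
    qed simp
    moreover have "(\<Sum>t<M. P i t * Q (bT t) {bT j}) - (if i = j then \<epsilon> * \<epsilon> else 0) \<in> J"
      if ij: "i < M" "j < M" for i j
    proof -
      have "bT i = bT j \<longleftrightarrow> i = j"
        using bT ij by (auto simp: bij_betw_def inj_on_def)
      then show ?thesis
        using PQ[of "{bT i}" "{bT j}"] inT ij mk unfolding sumT P_def by simp
    qed
    ultimately have "(\<epsilon> * \<epsilon>) ^ M \<in> J"
      by (intro scalar_mod_ideal_factorization[OF J, where M = M and P = P
          and Q = "\<lambda>t j. Q (bT t) {bT j}"]) auto
    with eps' show False by blast
  qed
  moreover have "odd (n - m)" if "n - m = 1"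
    using that by simp
  ultimately show ?thesis by blast
qed

text \<open>Selecting rows, possibly with repetition, is multiplication by a matrix of zeros and
  ones.\<close>

lemma minor_reindex:
  assumes "\<And>i. i < m \<Longrightarrow> idx i < m" "K \<subseteq> {..<n}" "card K = m"
  shows "minor n (\<lambda>i. f (idx i)) m K \<in> mideal n f m"
proof -
  define P :: "'a mat" where "P = mat m m (\<lambda>(i, c). if c = idx i then 1 else 0)"
  define F where "F = mat m m (\<lambda>(i, j). f i (pick K j))"
  have PF: "P \<in> carrier_mat m m" "F \<in> carrier_mat m m" by (auto simp: P_def F_def)
  have "mat m m (\<lambda>(i, j). f (idx i) (pick K j)) = P * F"
  proof (rule eq_matI)
    fix i j assume "i < dim_row (P * F)" "j < dim_col (P * F)"
    then have ij: "i < m" "j < m" using PF by auto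
    then have "(P * F) $$ (i, j) = (\<Sum>c<m. (if c = idx i then 1 else 0) * f c (pick K j))"
      by (simp add: P_def F_def scalar_prod_def atLeast0LessThan)
    also have "\<dots> = (\<Sum>c<m. if c = idx i then f c (pick K j) else 0)"
      by (intro sum.cong) auto
    also have "\<dots> = f (idx i) (pick K j)"
      using assms(1)[OF ij(1)] by simp
    finally show "mat m m (\<lambda>(i, j). f (idx i) (pick K j)) $$ (i, j) = (P * F) $$ (i, j)"
      using ij by simp
  qed (use PF in auto)
  then have "tri m * minor n (\<lambda>i. f (idx i)) m K = det P * (tri m * minor n f m K)"
    using det_pick[OF assms(2,3)] det_mult[OF PF] unfolding F_def by metis
  then have "tri m * (tri m * minor n (\<lambda>i. f (idx i)) m K) = tri m * (det P * (tri m * minor n f m K))"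
    by simp
  then have "minor n (\<lambda>i. f (idx i)) m K = (tri m * det P * tri m) * minor n f m K"
    unfolding tri_sq_left by (simp add: mult.assoc)
  then show ?thesis
    using is_ideal_mult[OF is_ideal_mideal minor_in_mideal[OF assms(2,3)]] by simp
qed

lemma is_ideal_radical:
  assumes I: "is_ideal I"
  shows "is_ideal {x. \<exists>N. x ^ N \<in> I}"
  unfolding is_ideal_def
proof (intro conjI ballI allI)
  show "0 \<in> {x. \<exists>N. x ^ N \<in> I}"
    using is_ideal_zero[OF I] by (auto intro: exI[of _ 1])
next
  fix x y assume "x \<in> {x. \<exists>N. x ^ N \<in> I}" "y \<in> {x. \<exists>N. x ^ N \<in> I}"
  then obtain N M where NM: "x ^ N \<in> I" "y ^ M \<in> I" by auto
  have "(x + y) ^ (N + M) = (\<Sum>i\<le>N + M. of_nat (N + M choose i) * x ^ i * y ^ (N + M - i))"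
    by (rule binomial_ring)
  also have "\<dots> \<in> I"
  proof (rule is_ideal_sum[OF I])
    fix i assume "i \<in> {..N + M}"
    show "of_nat (N + M choose i) * x ^ i * y ^ (N + M - i) \<in> I"
    proof (cases "N \<le> i")
      case True
      then have "x ^ i = x ^ (i - N) * x ^ N" by (simp flip: power_add)
      then have "x ^ i \<in> I" using NM(1) is_ideal_mult[OF I] by metis
      then show ?thesis by (intro is_ideal_mult_right is_ideal_mult I)
    next
      case False
      then have "y ^ (N + M - i) = y ^ (N - i) * y ^ M" by (simp flip: power_add)
      then have "y ^ (N + M - i) \<in> I" using NM(2) is_ideal_mult[OF I] by metis
      then show ?thesis by (intro is_ideal_mult I)
    qed
  qed
  finally show "x + y \<in> {x. \<exists>N. x ^ N \<in> I}" by blast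
next
  fix r x assume "x \<in> {x. \<exists>N. x ^ N \<in> I}"
  then obtain N where "x ^ N \<in> I" by auto
  then have "(r * x) ^ N \<in> I" by (simp add: power_mult_distrib is_ideal_mult[OF I])
  then show "r * x \<in> {x. \<exists>N. x ^ N \<in> I}" by blast
qed

text \<open>Modulo the radical of the ideal the minors of size \<open>m\<close> vanish and the empty
  minor 1 does not. At some size \<open>k\<close> a minor survives while all those of size
  \<open>k + 1\<close> vanish; since \<open>J\<close> is radical, no power of the surviving one lies
  in \<open>J\<close>.\<close>

lemma row_codimension_odd:
  fixes f :: "nat \<Rightarrow> nat \<Rightarrow> 'a::comm_ring_1"
  assumes reg: "regular_seq (mideal n f m) xs" "Suc (n - m) \<le> length xs" and "m < n"
    and ker: "\<And>i. i < m \<Longrightarrow> pairing n (f i) g = 0"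
    and sub: "mideal n f m \<subseteq> ideal_gen (g ` {..<n})"
    and proper: "mideal n f m \<noteq> UNIV"
  shows "odd (n - m)"
proof -
  define I where "I = mideal n f m"
  define J where "J = {x. \<exists>N. x ^ N \<in> I}"
  have I: "is_ideal I" unfolding I_def by (rule is_ideal_mideal)
  have J: "is_ideal J" unfolding J_def by (rule is_ideal_radical[OF I])
  define P where "P k \<longleftrightarrow> (\<forall>idx K. (\<forall>i<k. idx i < m) \<longrightarrow> K \<subseteq> {..<n} \<longrightarrow> card K = k \<longrightarrow>
    minor n (\<lambda>i. f (idx i)) k K \<in> J)" for k
  have "P m"
    unfolding P_def
  proof (intro allI impI)
    fix idx K assume "\<forall>i<m. idx i < m" "K \<subseteq> {..<n}" "card K = m"
    then have "minor n (\<lambda>i. f (idx i)) m K ^ 1 \<in> I"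
      unfolding I_def power_one_right by (intro minor_reindex) auto
    then show "minor n (\<lambda>i. f (idx i)) m K \<in> J" unfolding J_def by blast
  qed
  moreover have "1 \<notin> I"
    using proper is_ideal_UNIV_iff[OF I] I_def by auto
  then have "1 \<notin> J" by (simp add: J_def)
  then have "\<not> P 0"
    unfolding P_def by (auto simp: minor_0 bas_def intro!: exI[of _ "{}"])
  ultimately obtain k where k: "k < m" "\<not> P k" "P (Suc k)"
    using ex_least_nat_less[of P m] by auto
  then obtain idx K where idx: "\<forall>i<k. idx i < m" "K \<subseteq> {..<n}" "card K = k"
    "minor n (\<lambda>i. f (idx i)) k K \<notin> J"
    unfolding P_def by blast
  have "minor n (\<lambda>i. f (idx i)) k K ^ N \<notin> J" for N
  proof
    assume "minor n (\<lambda>i. f (idx i)) k K ^ N \<in> J"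
    then obtain N' where "minor n (\<lambda>i. f (idx i)) k K ^ (N * N') \<in> I"
      unfolding J_def by (auto simp: power_mult)
    with idx(4) show False unfolding J_def by blast
  qed
  with row_codimension[OF reg \<open>m < n\<close> ker sub J k(1) _ idx(2,3), of idx] idx(1) k(3)
  show ?thesis unfolding P_def by blast
qed

text \<open>The case \<open>k = 0\<close>: the empty minor is 1, and minors of size 1 are entries,
  all in the proper ideal \<open>J\<close>.\<close>

lemma row_codimension_minimal:
  fixes f :: "nat \<Rightarrow> nat \<Rightarrow> 'a::comm_ring_1"
  assumes reg: "regular_seq (mideal n f m) xs" "Suc (n - m) \<le> length xs" and "m < n" "0 < m"
    and ker: "\<And>i. i < m \<Longrightarrow> pairing n (f i) g = 0"
    and sub: "mideal n f m \<subseteq> ideal_gen (g ` {..<n})"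
    and J: "is_ideal J" "J \<noteq> UNIV" "\<And>i j. i < m \<Longrightarrow> j < n \<Longrightarrow> f i j \<in> J"
  shows "n - m = 1 \<or> m = 1"
proof -
  have "1 \<notin> J" using J is_ideal_UNIV_iff by blast
  moreover have "minor n (\<lambda>i. f (idx' i)) (Suc 0) K' \<in> J"
    if "\<And>i. i < Suc 0 \<Longrightarrow> idx' i < m" for idx' K'
    using that by (intro minor_in_ideal[OF J(1)] J(3)) auto
  ultimately show ?thesis
    using row_codimension[OF reg \<open>m < n\<close> ker sub J(1) \<open>0 < m\<close>, of "\<lambda>i. i" "{}"]
    by (simp add: minor_0 bas_def)
qed

subsection \<open>Grade and ideals of maximal minors\<close>

lemma minor_1: "j < n \<Longrightarrow> minor n f (Suc 0) {j} = f 0 j"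
  by (simp add: minor_Suc minor_0 wdg_bas_empty_singleton)

lemma mideal_1: "mideal n f (Suc 0) = ideal_gen (f 0 ` {..<n})"
proof
  show "mideal n f (Suc 0) \<subseteq> ideal_gen (f 0 ` {..<n})"
    using ideal_gen_superset[of "f 0 ` {..<n}"]
    by (intro mideal_subset is_ideal_gen) auto
  have "f 0 j \<in> mideal n f (Suc 0)" if "j < n" for j
    using minor_in_mideal[of "{j}" n "Suc 0" f] that by (simp add: minor_1)
  then show "ideal_gen (f 0 ` {..<n}) \<subseteq> mideal n f (Suc 0)"
    by (intro ideal_gen_least is_ideal_mideal) auto
qed

lemma mideal_eq_det:
  "mideal n f l = ideal_gen {det (mat l l (\<lambda>(i, j). f i (pick K j))) | K. K \<subseteq> {..<n} \<and> card K = l}"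
    (is "_ = ideal_gen ?D")
proof
  have "minor n f l K \<in> ideal_gen ?D" if K: "K \<subseteq> {..<n}" "card K = l" for K
  proof -
    have "minor n f l K = tri l * det (mat l l (\<lambda>(i, j). f i (pick K j)))"
      unfolding det_pick[OF K] by (simp add: tri_sq_left)
    moreover have "det (mat l l (\<lambda>(i, j). f i (pick K j))) \<in> ideal_gen ?D"
      by (rule subsetD[OF ideal_gen_superset]) (use K in blast)
    ultimately show ?thesis by (simp add: is_ideal_mult[OF is_ideal_gen])
  qed
  then show "mideal n f l \<subseteq> ideal_gen ?D"
    unfolding mideal_def by (intro ideal_gen_least is_ideal_gen) auto
  have "det (mat l l (\<lambda>(i, j). f i (pick K j))) \<in> mideal n f l" if K: "K \<subseteq> {..<n}" "card K = l" for K
    unfolding det_pick[OF K] by (intro is_ideal_mult is_ideal_mideal minor_in_mideal K)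
  then show "ideal_gen ?D \<subseteq> mideal n f l"
    by (intro ideal_gen_least is_ideal_mideal) auto
qed

section \<open>Maximal minors of matrices, and grade\<close>

lemma pick_lessThan: "i < l \<Longrightarrow> pick {..<l} i = i"
proof -
  assume "i < l"
  then have "{a \<in> {..<l}. a < i} = {..<i}" by auto
  with pick_card_in_set[of i "{..<l}"] \<open>i < l\<close> show ?thesis by simp
qed

lemma submatrix_rows:
  assumes "A \<in> carrier_mat l n" "K \<subseteq> {..<n}" "card K = l"
  shows "submatrix A {..<l} K = mat l l (\<lambda>(i, j). A $$ (i, pick K j))"
proof -
  have "{i. i < l \<and> i \<in> {..<l}} = {..<l}" "{j. j < n \<and> j \<in> K} = K"
    using assms(2) by auto
  then show ?thesis
    using assms by (intro eq_matI) (auto simp: submatrix_def pick_lessThan)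
qed

lemma submatrix_cols:
  assumes "A \<in> carrier_mat n l" "K \<subseteq> {..<n}" "card K = l"
  shows "submatrix A K {..<l} = transpose_mat (mat l l (\<lambda>(i, j). A $$ (pick K j, i)))"
proof -
  have "{i. i < l \<and> i \<in> {..<l}} = {..<l}" "{j. j < n \<and> j \<in> K} = K"
    using assms(2) by auto
  then show ?thesis
    using assms by (intro eq_matI) (auto simp: submatrix_def pick_lessThan)
qed

lemma maxminors_ideal_rows:
  assumes A: "A \<in> carrier_mat l n" and "l \<le> n"
  shows "maxminors_ideal A = mideal n (\<lambda>i j. A $$ (i, j)) l"
proof -
  have "I \<subseteq> {..<l} \<and> card I = l \<longleftrightarrow> I = {..<l}" for I
    using card_subset_eq[of "{..<l}" I] by auto
  then have "{det (submatrix A I J) | I J. I \<subseteq> {..<l} \<and> J \<subseteq> {..<n} \<and> card I = l \<and> card J = l}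
      = {det (submatrix A {..<l} K) | K. K \<subseteq> {..<n} \<and> card K = l}"
    by (intro Collect_cong) metis
  also have "\<dots> = {det (mat l l (\<lambda>(i, j). A $$ (i, pick K j))) | K. K \<subseteq> {..<n} \<and> card K = l}"
    using submatrix_rows[OF A] by (intro Collect_cong ex_cong1) auto
  finally show ?thesis
    using A \<open>l \<le> n\<close> by (simp add: maxminors_ideal_def mideal_eq_det min_absorb1)
qed

lemma maxminors_ideal_cols:
  assumes A: "A \<in> carrier_mat n l" and "l \<le> n"
  shows "maxminors_ideal A = mideal n (\<lambda>i j. A $$ (j, i)) l"
proof -
  have "J \<subseteq> {..<l} \<and> card J = l \<longleftrightarrow> J = {..<l}" for J
    using card_subset_eq[of "{..<l}" J] by auto
  then have "{det (submatrix A I J) | I J. I \<subseteq> {..<n} \<and> J \<subseteq> {..<l} \<and> card I = l \<and> card J = l}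
      = {det (submatrix A K {..<l}) | K. K \<subseteq> {..<n} \<and> card K = l}"
    by (intro Collect_cong) metis
  also have "\<dots> = {det (mat l l (\<lambda>(i, j). A $$ (pick K j, i))) | K. K \<subseteq> {..<n} \<and> card K = l}"
  proof -
    have "det (submatrix A K {..<l}) = det (mat l l (\<lambda>(i, j). A $$ (pick K j, i)))"
      if "K \<subseteq> {..<n}" "card K = l" for K
      unfolding submatrix_cols[OF A that] by (rule det_transpose[of _ l]) simp
    then show ?thesis by (intro Collect_cong ex_cong1) auto
  qed
  finally show ?thesis
    using A \<open>l \<le> n\<close> by (simp add: maxminors_ideal_def mideal_eq_det min_absorb2)
qed

lemma grade_greaterE:
  assumes "enat k < grade I" "I \<noteq> UNIV"
  obtains xs where "regular_seq I xs" "k < length xs"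
proof -
  have "enat k < Sup {enat (length xs) | xs. regular_seq I xs}"
    using assms by (simp add: grade_def)
  then obtain xs where "regular_seq I xs" "enat k < enat (length xs)"
    unfolding less_Sup_iff by auto
  with that show thesis by simp
qed

lemma grade_mono:
  assumes "I \<subseteq> I'" "I' \<noteq> UNIV"
  shows "grade I \<le> grade I'"
proof -
  have "regular_seq I xs \<Longrightarrow> regular_seq I' xs" for xs
    using assms(1) by (auto simp: regular_seq_def)
  then have "Sup {enat (length xs) | xs. regular_seq I xs} \<le> Sup {enat (length xs) | xs. regular_seq I' xs}"
    by (intro Sup_subset_mono) auto
  moreover have "I \<noteq> UNIV" using assms by auto
  ultimately show ?thesis using assms(2) by (simp add: grade_def)
qed

lemma mult_eq_zero_pairing:
  assumes "L \<in> carrier_mat l n" "\<chi> \<in> carrier_mat n m"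
  shows "L * \<chi> = 0\<^sub>m l m \<longleftrightarrow> (\<forall>i<l. \<forall>k<m. pairing n (\<lambda>j. L $$ (i, j)) (\<lambda>j. \<chi> $$ (j, k)) = 0)"
proof -
  have "(L * \<chi>) $$ (i, k) = pairing n (\<lambda>j. L $$ (i, j)) (\<lambda>j. \<chi> $$ (j, k))" if "i < l" "k < m" for i k
    using assms that by (simp add: scalar_prod_def pairing_def atLeast0LessThan)
  moreover have "L * \<chi> = 0\<^sub>m l m \<longleftrightarrow> (\<forall>i<l. \<forall>k<m. (L * \<chi>) $$ (i, k) = 0)"
    using assms by (auto simp: mat_eq_iff)
  ultimately show ?thesis by auto
qed

section \<open>Construction of rows that generate the ideal of minors\<close>

lemma sum_alternating_pairs:
  fixes x :: "nat \<Rightarrow> 'a::comm_ring_1"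
  shows "(\<Sum>j<2 * p. (if even j then x (Suc j) else - x (j - 1)) * x j) = 0"
  by (induction p) (simp_all add: mult.commute)

text \<open>The row consists of the maximal minors with signs. Contracting once more by
  \<open>f k\<close> repeats a form and gives zero.\<close>

lemma exists_row_corank_1:
  fixes f :: "nat \<Rightarrow> nat \<Rightarrow> 'a::comm_ring_1"
  assumes "n = Suc m"
  shows "\<exists>g. (\<forall>k<m. pairing n g (f k) = 0) \<and> mideal n f m \<subseteq> ideal_gen (g ` {..<n})"
proof -
  define g where "g j = Fs n f m (bas {..<n}) {j}" for j
  have "pairing n g (f k) = 0" if "k < m" for k
  proof -
    have "pairing n g (f k) = ctr n (f k) (Fs n f m (bas {..<n})) {}"
      by (simp add: ctr_apply pairing_def g_def mult.commute)
    then show ?thesis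
      by (simp add: ctr_Fs_eq_0[OF that] pointwise)
  qed
  moreover have "minor n f m K \<in> ideal_gen (g ` {..<n})" if K: "K \<subseteq> {..<n}" "card K = m" for K
  proof -
    have "finite K" using K(1) finite_subset by blast
    then have "card ({..<n} - K) = 1"
      using K assms by (simp add: card_Diff_subset)
    then obtain j where "{..<n} - K = {j}" by (auto simp: card_1_singleton_iff)
    then have j: "j < n" "{j} \<inter> K = {}" "K \<union> {j} = {..<n}" using K(1) by auto
    obtain \<sigma> where \<sigma>: "\<sigma> * \<sigma> = 1" "g j = \<sigma> * minor n f m K"
      using Fs_bas_union[of "{j}" K n f m] j unfolding g_def by auto
    then have "minor n f m K = \<sigma> * g j"
      by (simp flip: mult.assoc)
    moreover have "g j \<in> ideal_gen (g ` {..<n})"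
      by (rule subsetD[OF ideal_gen_superset]) (use j in auto)
    ultimately show ?thesis by (simp add: is_ideal_mult[OF is_ideal_gen])
  qed
  then have "mideal n f m \<subseteq> ideal_gen (g ` {..<n})"
    unfolding mideal_def by (intro ideal_gen_least is_ideal_gen) auto
  ultimately show ?thesis by blast
qed

text \<open>The entries are swapped in consecutive pairs with one sign changed, so up to sign and
  order they stay the same.\<close>

lemma exists_row_rank_1:
  fixes f :: "nat \<Rightarrow> nat \<Rightarrow> 'a::comm_ring_1"
  assumes "even n"
  shows "\<exists>g. pairing n g (f 0) = 0 \<and> mideal n f (Suc 0) \<subseteq> ideal_gen (g ` {..<n})"
proof -
  define g where "g j = (if even j then f 0 (Suc j) else - f 0 (j - 1))" for j
  have "pairing n g (f 0) = 0"
    using assms sum_alternating_pairs[of "f 0" "n div 2"] by (simp add: pairing_def g_def)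
  moreover have "f 0 j \<in> ideal_gen (g ` {..<n})" if "j < n" for j
  proof (cases "even j")
    case True
    then have "Suc j < n" using that assms by (metis Suc_lessI even_Suc)
    then have "g (Suc j) \<in> ideal_gen (g ` {..<n})"
      by (intro subsetD[OF ideal_gen_superset]) auto
    then show ?thesis
      using True is_ideal_uminus[OF is_ideal_gen, of "g (Suc j)" "g ` {..<n}"] by (simp add: g_def)
  next
    case False
    then have "g (j - 1) = f 0 j" by (cases j) (auto simp: g_def)
    moreover have "g (j - 1) \<in> ideal_gen (g ` {..<n})"
      using that by (intro subsetD[OF ideal_gen_superset]) auto
    ultimately show ?thesis by simp
  qed
  then have "mideal n f (Suc 0) \<subseteq> ideal_gen (g ` {..<n})"
    unfolding mideal_1 by (intro ideal_gen_least is_ideal_gen) auto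
  ultimately show ?thesis by blast
qed

section \<open>Comparison of the two ideals of minors and the resulting equivalences\<close>

theorem mainTheorem12:
  fixes \<chi> :: "'a::comm_ring_1 mat" and m n l :: nat
  assumes "noetherian_ring TYPE('a)"
    and "\<chi> \<in> carrier_mat n m"
    and "m \<le> n"
    and "inj_on (\<lambda>x. \<chi> *\<^sub>v x) (carrier_vec m)"
    and "grade (maxminors_ideal \<chi>) = enat (n - m + 1)"
    and "1 \<le> l" and "l \<le> n"
  shows
    "(\<forall>L \<in> carrier_mat l n. L * \<chi> = 0\<^sub>m l m \<longrightarrow>
        maxminors_ideal L \<subseteq> maxminors_ideal \<chi> \<and> grade (maxminors_ideal L) \<le> enat (n - m + 1))
     \<and> ((\<exists>L \<in> carrier_mat l n. L * \<chi> = 0\<^sub>m l m \<and>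
           grade (maxminors_ideal L) > enat (nat \<bar>int (n - m) - int l\<bar> + 1))
         \<longrightarrow> l = 1 \<and> odd (n - m))
     \<and> (minimal_mat \<chi> \<longrightarrow>
          ((\<exists>L \<in> carrier_mat l n. L * \<chi> = 0\<^sub>m l m \<and>
              grade (maxminors_ideal L) > enat (nat \<bar>int (n - m) - int l\<bar> + 1))
           \<longleftrightarrow> l = 1 \<and> (n - m = 1 \<or> (m = 1 \<and> n - m \<ge> 3 \<and> odd (n - m)))))
     \<and> (\<forall>L \<in> carrier_mat l n. L * \<chi> = 0\<^sub>m l m \<longrightarrow>
          (grade (maxminors_ideal L) > enat (nat \<bar>int (n - m) - int l\<bar> + 1)
           \<longleftrightarrow> maxminors_ideal L = maxminors_ideal \<chi>))"
proof -
  note \<chi> = assms(2) and mn = assms(3) and gr = assms(5)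
  define f where "f = (\<lambda>i j. \<chi> $$ (j, i))"
  define I where "I = maxminors_ideal \<chi>"
  define row where "row = (\<lambda>(L :: 'a mat) i j. L $$ (i, j))"
  let ?kills = "\<lambda>L. L * \<chi> = 0\<^sub>m l m"
  let ?large = "\<lambda>L. enat (nat \<bar>int (n - m) - int l\<bar> + 1) < grade (maxminors_ideal L)"
  have I_f: "I = mideal n f m"
    unfolding I_def f_def by (rule maxminors_ideal_cols[OF \<chi> mn])
  have is_I: "is_ideal I"
    unfolding I_f by (rule is_ideal_mideal)
  \<comment> \<open>The whole ring has infinite grade, while that of \<open>I\<close> is
    finite.\<close>
  have proper: "I \<noteq> UNIV"
    using gr unfolding I_def[symmetric] grade_def by auto
  have "enat (n - m) < grade I"
    using gr by (simp add: I_def)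
  then obtain xs where reg: "regular_seq (mideal n f m) xs" and "n - m < length xs"
    using proper unfolding I_f by (rule grade_greaterE)
  then have len: "Suc (n - m) \<le> length xs" by simp
  obtain a where a: "a \<in> I" "\<And>y. a * y = 0 \<Longrightarrow> y = 0"
  proof
    have xs: "0 < length xs" using len by linarith
    show "xs ! 0 \<in> I"
      using reg nth_mem[OF xs] unfolding regular_seq_def I_f by blast
    show "y = 0" if "xs ! 0 * y = 0" for y
      using reg xs that by (auto simp: regular_seq_def ideal_gen_empty)
  qed
  have "a \<noteq> 0" using a(2)[of 1] by auto
  \<comment> \<open>For \<open>m = 0\<close> the empty minor 1 would lie in
    \<open>I\<close>.\<close>
  have m_pos: "0 < m"
  proof (rule ccontr)
    assume "\<not> 0 < m"
    then have "1 \<in> I"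
      using minor_in_mideal[of "{}" n m f] by (simp add: I_f minor_0 bas_def)
    with proper is_ideal_UNIV_iff[OF is_I] show False by blast
  qed
  have row_ideal: "maxminors_ideal L = mideal n (row L) l" if "L \<in> carrier_mat l n" for L
    unfolding row_def using maxminors_ideal_rows[OF that \<open>l \<le> n\<close>] .
  have kernel: "pairing n (row L i) (f k) = 0" "pairing n (f k) (row L i) = 0"
    if "L \<in> carrier_mat l n" "?kills L" "i < l" "k < m" for L i k
    using that mult_eq_zero_pairing[OF that(1) \<chi>] unfolding row_def f_def
    by (auto simp: pairing_commute)
  have entries: "row L i j \<in> I" if "L \<in> carrier_mat l n" "?kills L" "i < l" "j < n" for L i j
    unfolding I_f using kernel(2)[OF that(1-3)] that(4)
    by (intro left_kernel_in_mideal[OF reg len]) auto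
  have sub: "maxminors_ideal L \<subseteq> I" if "L \<in> carrier_mat l n" "?kills L" for L
    unfolding row_ideal[OF that(1)] using entries[OF that] \<open>1 \<le> l\<close> by (intro mideal_subset is_I)
  have sup: "I \<subseteq> maxminors_ideal L" if L: "L \<in> carrier_mat l n" "?kills L" "?large L" for L
  proof (cases "maxminors_ideal L = UNIV")
    case False
    with L(3) obtain ys where "regular_seq (mideal n (row L) l) ys"
      "nat \<bar>int (n - m) - int l\<bar> + 1 < length ys"
      unfolding row_ideal[OF L(1)] by (rule grade_greaterE)
    \<comment> \<open>The truncated subtraction covers both signs of \<rho>: exactness in degree
      \<open>m\<close> needs \<rho> + 2 regular elements if \<rho> is nonnegative, and a single one
      otherwise.\<close>
    moreover from this have "Suc (Suc n - (m + l)) \<le> length ys"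
      using mn by linarith
    ultimately show ?thesis
      unfolding row_ideal[OF L(1)] I_f using kernel(1)[OF L(1,2)] by (intro mideal_subset_mideal)
  qed simp
  have l1: "l = 1" if L: "L \<in> carrier_mat l n" "?kills L" "I \<subseteq> maxminors_ideal L" for L
  proof (rule ccontr)
    assume "l \<noteq> 1"
    then have "2 \<le> l" using \<open>1 \<le> l\<close> by simp
    then have "mideal n (row L) l \<subseteq> ideal_square I"
      using entries[OF L(1,2)] by (intro mideal_subset_square is_I)
    then have "I \<subseteq> ideal_square I"
      using L(3) unfolding row_ideal[OF L(1)] by blast
    moreover have "finite {minor n f m K | K. K \<subseteq> {..<n} \<and> card K = m}"
    proof -
      have "finite (minor n f m ` Pow {..<n})" by simp
      then show ?thesis by (rule rev_finite_subset) auto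
    qed
    ultimately have "I = UNIV"
      using a by (intro idempotent_ideal_eq_UNIV[of _ I a]) (auto simp: I_f mideal_def)
    with proper show False ..
  qed
  have row0: "maxminors_ideal L = ideal_gen (row L 0 ` {..<n})"
    if "L \<in> carrier_mat l n" "l = 1" for L
    unfolding row_ideal[OF that(1)] that(2) One_nat_def by (rule mideal_1)
  \<comment> \<open>For \<open>m = n\<close> a row that annihilates \<chi> is a full contraction of
    an element of degree above \<open>n\<close>, hence zero, whereas \<open>I\<close> contains
    \<open>a \<noteq> 0\<close>.\<close>
  have less: "m < n" if L: "L \<in> carrier_mat l n" "?kills L" "I \<subseteq> maxminors_ideal L" for L
  proof (rule ccontr)
    assume "\<not> m < n"
    then have "n < Suc m" by simp
    have "row L 0 j = 0" if "j < n" for j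
    proof -
      obtain b where "low n (Suc m) b" "wdg n (row L 0) (bas {}) = Fs n f m b"
        using left_kernel_eq_Fs[OF reg len, of "row L 0"] kernel(2)[OF L(1,2)] \<open>1 \<le> l\<close> by auto
      then have "wdg n (row L 0) (bas {}) = 0"
        using low_eq_0[OF _ \<open>n < Suc m\<close>] lin_zero[OF lin_Fs] by metis
      then show ?thesis
        using wdg_bas_empty_singleton[OF that, of "row L 0"] by (simp add: pointwise)
    qed
    then have "ideal_gen (row L 0 ` {..<n}) \<subseteq> {0}"
      by (intro ideal_gen_least is_ideal_trivial) auto
    with L(3) a(1) \<open>a \<noteq> 0\<close> show False
      unfolding row0[OF L(1) l1[OF L]] by blast
  qed
  have odd: "odd (n - m)" if L: "L \<in> carrier_mat l n" "?kills L" "I \<subseteq> maxminors_ideal L" for L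
  proof (rule row_codimension_odd[OF reg len less[OF L]])
    show "pairing n (f i) (row L 0) = 0" if "i < m" for i
      using kernel(2)[OF L(1,2) _ that] \<open>1 \<le> l\<close> by simp
    show "mideal n f m \<subseteq> ideal_gen (row L 0 ` {..<n})"
      using L(3) unfolding row0[OF L(1) l1[OF L]] I_f .
    show "mideal n f m \<noteq> UNIV"
      using proper unfolding I_f .
  qed
  have minimal: "n - m = 1 \<or> m = 1"
    if L: "L \<in> carrier_mat l n" "?kills L" "I \<subseteq> maxminors_ideal L" and min: "minimal_mat \<chi>" for L
  proof (rule row_codimension_minimal[OF reg len less[OF L] m_pos])
    show "pairing n (f i) (row L 0) = 0" if "i < m" for i
      using kernel(2)[OF L(1,2) _ that] \<open>1 \<le> l\<close> by simp
    show "mideal n f m \<subseteq> ideal_gen (row L 0 ` {..<n})"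
      using L(3) unfolding row0[OF L(1) l1[OF L]] I_f .
    let ?J = "ideal_gen {\<chi> $$ (i, j) | i j. i < dim_row \<chi> \<and> j < dim_col \<chi>}"
    show "is_ideal ?J" by (rule is_ideal_gen)
    show "?J \<noteq> UNIV" using min by (simp add: minimal_mat_def)
    show "f i j \<in> ?J" if "i < m" "j < n" for i j
      by (rule subsetD[OF ideal_gen_superset]) (use that \<chi> in \<open>auto simp: f_def\<close>)
  qed
  have large: "?large L" if L: "L \<in> carrier_mat l n" "?kills L" "maxminors_ideal L = I" for L
  proof -
    have "I \<subseteq> maxminors_ideal L" using L(3) by simp
    from l1[OF L(1,2) this] less[OF L(1,2) this] have "l = 1" "m < n" by auto
    \<comment> \<open>The left-hand side is \<open>n - m\<close>, one less than the grade of
      \<open>I\<close>.\<close>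
    then have "nat \<bar>int (n - m) - int l\<bar> + 1 < n - m + 1" by linarith
    then show ?thesis
      using gr L(3) by (simp add: I_def)
  qed
  have part_c: "?large L \<longleftrightarrow> maxminors_ideal L = I" if "L \<in> carrier_mat l n" "?kills L" for L
    using sub[OF that] sup[OF that] large[OF that] by blast
  \<comment> \<open>One inclusion suffices: the other holds for every annihilating row, and equality
    of the ideals gives the large grade.\<close>
  have realize: "\<exists>L\<in>carrier_mat l n. ?kills L \<and> ?large L"
    if "l = 1" "\<forall>k<m. pairing n g (f k) = 0" "I \<subseteq> ideal_gen (g ` {..<n})" for g
  proof -
    define L where "L = mat 1 n (\<lambda>(i, j). g j)"
    have L: "L \<in> carrier_mat l n" by (simp add: L_def that(1))
    have g: "pairing n (row L 0) h = pairing n g h" "row L 0 ` {..<n} = g ` {..<n}" for h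
      by (auto simp: pairing_def row_def L_def)
    have "?kills L"
      unfolding mult_eq_zero_pairing[OF L \<chi>] using that(1,2) g(1) unfolding row_def f_def by simp
    moreover have "I \<subseteq> maxminors_ideal L"
      unfolding row0[OF L that(1)] g(2) by (rule that(3))
    ultimately show ?thesis
      using L sub[OF L] part_c[OF L] by blast
  qed
  have exists: "\<exists>L\<in>carrier_mat l n. ?kills L \<and> ?large L"
    if "l = 1" "n - m = 1 \<or> (m = 1 \<and> n - m \<ge> 3 \<and> odd (n - m))"
    using that(2)
  proof
    assume "n - m = 1"
    then have "n = Suc m" by simp
    from exists_row_corank_1[OF this, of f] show ?thesis
      using realize[OF that(1)] unfolding I_f by blast
  next
    assume m: "m = 1 \<and> n - m \<ge> 3 \<and> odd (n - m)"
    then have "even n" by presburger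
    from exists_row_rank_1[OF this, of f] obtain g where
      "pairing n g (f 0) = 0" "mideal n f (Suc 0) \<subseteq> ideal_gen (g ` {..<n})" by blast
    with m show ?thesis
      using realize[OF that(1), of g] unfolding I_f by simp
  qed
  show ?thesis
    unfolding I_def[symmetric]
  proof (intro conjI impI ballI)
    fix L assume L: "L \<in> carrier_mat l n" "?kills L"
    show "maxminors_ideal L \<subseteq> I" by (rule sub[OF L])
    show "grade (maxminors_ideal L) \<le> enat (n - m + 1)"
      using grade_mono[OF sub[OF L] proper] gr by (simp add: I_def)
    show "?large L \<longleftrightarrow> maxminors_ideal L = I" by (rule part_c[OF L])
  next
    assume "\<exists>L\<in>carrier_mat l n. ?kills L \<and> ?large L"
    then obtain L where L: "L \<in> carrier_mat l n" "?kills L" "?large L" by blast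
    show "l = 1" "odd (n - m)"
      using l1[OF L(1,2) sup[OF L]] odd[OF L(1,2) sup[OF L]] by auto
  next
    assume min: "minimal_mat \<chi>"
    show "(\<exists>L\<in>carrier_mat l n. ?kills L \<and> ?large L)
      \<longleftrightarrow> l = 1 \<and> (n - m = 1 \<or> (m = 1 \<and> n - m \<ge> 3 \<and> odd (n - m)))"
    proof
      assume "\<exists>L\<in>carrier_mat l n. ?kills L \<and> ?large L"
      then obtain L where L: "L \<in> carrier_mat l n" "?kills L" "?large L" by blast
      have "odd (n - m)" "n - m = 1 \<or> m = 1" "l = 1"
        using odd[OF L(1,2) sup[OF L]] minimal[OF L(1,2) sup[OF L] min] l1[OF L(1,2) sup[OF L]] by auto
      then show "l = 1 \<and> (n - m = 1 \<or> (m = 1 \<and> n - m \<ge> 3 \<and> odd (n - m)))"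
        by presburger
    qed (use exists in blast)
  qed
qed

end
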